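(* If $X$ is a Flag fan and $\phi=\phi_{\mathcal A}$ is a cut function on $X$, then $Y=\phi_{\mathcal A}\cdot X$ is a Flag fan.
   Context: Tropical fans. A $k$-dimensional tropical fan in $\mathbb R^n=\mathbb Z^n\otimes\mathbb R$ is a finite collection of $k$-dimensional rational cones $\sigma$ (with their faces) with integer weights $\omega(\sigma)$ such that at each $(k-1)$-dimensional face $\tau$ one has $\sum_{\sigma\supset\tau}\omega(\sigma)u_{\sigma/\tau}=0$ in $\mathbb R^n/V_\tau$, where $V_\rho$ is the span of $\rho$ and $u_{\sigma/\tau}$ is the primitive generator of $(V_\sigma\cap\mathbb Z^n)/(V_\tau\cap\mathbb Z^n)$ pointing inside $\sigma$. A rational function $\phi$ on $X$ is a continuous function on the union of its cones which is linear on each of them. Its Weil divisor $\phi\cdot X$ is the $(k-1)$-dimensional tropical fan with weights $\omega_{\phi\cdot X}(\tau)=\sum_{\sigma\supset\tau}\omega_X(\sigma)\phi(v_{\sigma/\tau})-\phi\bigl(\sum_{\sigma\supset\tau}\omega_X(\sigma)v_{\sigma/\tau}\bigr)$ on $(k-1)$-dimensional cones $\tau$ of $X$, where $v_{\sigma/\tau}$ is any representative of $u_{\sigma/\tau}$. Flag fans. Let $E$ be a finite set, $e_F\in\mathbb R^E$ the characteristic vector of $F\subset E$. Consider a pair $(\mathcal G,\omega_{\mathcal G})$ consisting of a ranked poset $\mathcal G$ of subsets of $E$ ($\varnothing,E\in\mathcal G$; if $X\le_{\mathcal G}X'$ then $X\subset X'$, but not necessarily vice versa) and an edge weight function $\omega_{\mathcal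 G}\colon\{(F,F')\in\mathcal G\times\mathcal G: F\lessdot_{\mathcal G}F'\}\to\mathbb Z$ ($\lessdot_{\mathcal G}$ is the covering relation). The Flag fan corresponding to the pair is a tropical fan in $\mathbb R^E$ such that each cone is generated by the characteristic vectors of a set of pairwise comparable elements of $\mathcal G$ (a flag), and the weight of the maximal cone of $\varnothing=F_0\lessdot F_1\lessdot\dots\lessdot F_r=E$ is $\prod_{i=0}^{r-1}\omega_{\mathcal G}(F_i,F_{i+1})$; copies of cones with $e_E$ replaced by $-e_E$ are added with the same weights. Cuts. A cut on $\mathcal G$ is a subset $\mathcal A\subset\mathcal G$ such that if $F'\supset F\in\mathcal A$, $F'\in\mathcal G$, then $F'\in\mathcal A$. The cut function $\phi_{\mathcal A}$ on the Flag fan of $\mathcal G$ is the conewise linear function equal to $-1$ on $e_F$ for $F\in\mathcal A$ and $0$ on $e_F$ for the other $F$, and with $\phi_{\mathcal A}(-e_E)=-\phi_{\mathcal A}(e_E)$. *)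

theory Defs
  imports "HOL-Analysis.Analysis"
begin

section \<open>Tropical fans in \<open>\<real>\<^sup>n\<close>\<close>

definition int_lattice :: "(real ^ 'n::finite) set" where
  "int_lattice = {v. \<forall>i. v $ i \<in> \<int>}"

definition rational_cone :: "(real ^ 'n::finite) set \<Rightarrow> bool" where
  "rational_cone \<sigma> \<longleftrightarrow>
     (\<exists>S. finite S \<and> S \<subseteq> int_lattice \<and> \<sigma> = convex_cone hull S)"

text \<open>
  Only the top-dimensional cones and their weights are recorded; all other cones are faces of
  these. Weights are real because the Weil divisor is defined for arbitrary real-valued
  conewise linear functions; integrality is part of \<open>tropical_fan\<close>.
  Values of \<open>weight\<close> outside \<open>cones\<close> are irrelevant.
\<close>

record 'v weighted_fan =
  cones :: "'v set set"
  weight :: "'v set \<Rightarrow> real"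

definition star :: "(real ^ 'n::finite) weighted_fan \<Rightarrow> (real ^ 'n) set \<Rightarrow> (real ^ 'n) set set" where
  "star X \<tau> = {\<sigma> \<in> cones X. \<tau> facet_of \<sigma>}"

text \<open>
  \<open>primitive_rep \<sigma> \<tau> v\<close>: the class of \<open>v\<close> generates the quotient of lattices
  \<open>(V\<^sub>\<sigma> \<inter> \<int>\<^sup>n) / (V\<^sub>\<tau> \<inter> \<int>\<^sup>n)\<close>, and lies in the image of \<open>\<sigma>\<close> in \<open>V\<^sub>\<sigma> / V\<^sub>\<tau>\<close>.
\<close>

definition primitive_rep ::
    "(real ^ 'n::finite) set \<Rightarrow> (real ^ 'n) set \<Rightarrow> real ^ 'n \<Rightarrow> bool" where
  "primitive_rep \<sigma> \<tau> v \<longleftrightarrow>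
     v \<in> span \<sigma> \<inter> int_lattice \<and>
     (\<forall>x \<in> span \<sigma> \<inter> int_lattice. \<exists>(m::int). \<exists>w \<in> span \<tau> \<inter> int_lattice. x = of_int m *\<^sub>R v + w) \<and>
     (\<exists>w \<in> span \<tau>. v + w \<in> \<sigma>)"

text \<open>
  A chosen representative \<open>v\<^sub>\<sigma>\<^sub>/\<^sub>\<tau>\<close> of \<open>u\<^sub>\<sigma>\<^sub>/\<^sub>\<tau>\<close>; neither the balancing condition nor the weights
  of the Weil divisor depend on the choice.
\<close>

definition primitive_vec :: "(real ^ 'n::finite) set \<Rightarrow> (real ^ 'n) set \<Rightarrow> real ^ 'n" where
  "primitive_vec \<sigma> \<tau> = (SOME v. primitive_rep \<sigma> \<tau> v)"

definition tropical_fan :: "nat \<Rightarrow> (real ^ 'n::finite) weighted_fan \<Rightarrow> bool" where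
  "tropical_fan k X \<longleftrightarrow>
     finite (cones X) \<and>
     (\<forall>\<sigma> \<in> cones X. rational_cone \<sigma> \<and> dim \<sigma> = k \<and> weight X \<sigma> \<in> \<int>) \<and>
     (\<forall>\<sigma> \<in> cones X. \<forall>\<sigma>' \<in> cones X. \<sigma> \<inter> \<sigma>' face_of \<sigma>) \<and>
     (\<forall>\<tau>. star X \<tau> \<noteq> {} \<longrightarrow>
        (\<Sum>\<sigma> \<in> star X \<tau>. weight X \<sigma> *\<^sub>R primitive_vec \<sigma> \<tau>) \<in> span \<tau>)"

text \<open>
  Equality of tropical fans: cones of weight zero may be added or omitted. No subdivision of
  cones is allowed here.
\<close>

definition eff_weight :: "'v weighted_fan \<Rightarrow> 'v set \<Rightarrow> real" where
  "eff_weight X \<sigma> = (if \<sigma> \<in> cones X then weight X \<sigma> else 0)"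

definition same_fan :: "'v weighted_fan \<Rightarrow> 'v weighted_fan \<Rightarrow> bool" where
  "same_fan X Y \<longleftrightarrow> (\<forall>\<sigma>. eff_weight X \<sigma> = eff_weight Y \<sigma>)"

definition rational_function ::
    "(real ^ 'n::finite) weighted_fan \<Rightarrow> (real ^ 'n \<Rightarrow> real) \<Rightarrow> bool" where
  "rational_function X \<phi> \<longleftrightarrow>
     continuous_on (\<Union>(cones X)) \<phi> \<and>
     (\<forall>\<sigma> \<in> cones X. \<exists>g. linear g \<and> (\<forall>x \<in> \<sigma>. \<phi> x = g x))"

text \<open>
  In the formula for the weights of a Weil divisor, \<open>\<phi>\<close> is evaluated at \<open>v\<^sub>\<sigma>\<^sub>/\<^sub>\<tau> \<in> V\<^sub>\<sigma>\<close> and at a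
  vector of \<open>V\<^sub>\<tau>\<close>, which means the linear extension of \<open>\<phi>|\<^sub>\<sigma>\<close> to \<open>V\<^sub>\<sigma>\<close>, respectively of
  \<open>\<phi>|\<^sub>\<tau>\<close> to \<open>V\<^sub>\<tau>\<close>. The function chosen below is determined on \<open>span \<sigma>\<close> only.
\<close>

definition linear_ext ::
    "(real ^ 'n::finite \<Rightarrow> real) \<Rightarrow> (real ^ 'n) set \<Rightarrow> real ^ 'n \<Rightarrow> real" where
  "linear_ext \<phi> \<sigma> = (SOME g. linear g \<and> (\<forall>x \<in> \<sigma>. g x = \<phi> x))"

definition weil_divisor ::
    "(real ^ 'n::finite \<Rightarrow> real) \<Rightarrow> (real ^ 'n) weighted_fan \<Rightarrow> (real ^ 'n) weighted_fan" where
  "weil_divisor \<phi> X =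
     \<lparr> cones = {\<tau>. \<exists>\<sigma> \<in> cones X. \<tau> facet_of \<sigma>},
       weight = (\<lambda>\<tau>.
         (\<Sum>\<sigma> \<in> star X \<tau>. weight X \<sigma> * linear_ext \<phi> \<sigma> (primitive_vec \<sigma> \<tau>)) -
         linear_ext \<phi> \<tau> (\<Sum>\<sigma> \<in> star X \<tau>. weight X \<sigma> *\<^sub>R primitive_vec \<sigma> \<tau>)) \<rparr>"


section \<open>Flag fans\<close>

text \<open>The ground set \<open>E\<close> is the universe of the finite type \<open>'e\<close>.\<close>

definition char_vec :: "'e::finite set \<Rightarrow> real ^ 'e" where
  "char_vec F = (\<chi> i. indicator F i)"

definition covers :: "('e set \<times> 'e set) set \<Rightarrow> 'e set \<Rightarrow> 'e set \<Rightarrow> bool" where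
  "covers R F F' \<longleftrightarrow>
     (F, F') \<in> R \<and> F \<noteq> F' \<and>
     \<not> (\<exists>H. (F, H) \<in> R \<and> (H, F') \<in> R \<and> H \<noteq> F \<and> H \<noteq> F')"

text \<open>
  \<open>R\<close> is the order relation of the poset \<open>\<G>\<close>. It implies inclusion, but sets in \<open>\<G>\<close> may be
  nested without being comparable. The poset need not have \<open>{}\<close> as its least or the whole
  ground set as its greatest element; elements off the flags from \<open>{}\<close> to the ground set do
  not contribute to the Flag fan.
\<close>

definition ranked_set_poset :: "'e::finite set set \<Rightarrow> ('e set \<times> 'e set) set \<Rightarrow> bool" where
  "ranked_set_poset \<G> R \<longleftrightarrow>
     partial_order_on \<G> R \<and>
     {} \<in> \<G> \<and> UNIV \<in> \<G> \<and>
     (\<forall>F F'. (F, F') \<in> R \<longrightarrow> F \<subseteq> F') \<and>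
     (\<exists>\<rho> :: 'e set \<Rightarrow> nat. \<forall>F F'. covers R F F' \<longrightarrow> \<rho> F' = Suc (\<rho> F))"

definition maximal_flag :: "('e::finite set \<times> 'e set) set \<Rightarrow> 'e set list \<Rightarrow> bool" where
  "maximal_flag R Fs \<longleftrightarrow>
     Fs \<noteq> [] \<and> hd Fs = {} \<and> last Fs = UNIV \<and> successively (covers R) Fs"

definition flag_weight :: "('e set \<Rightarrow> 'e set \<Rightarrow> int) \<Rightarrow> 'e set list \<Rightarrow> int" where
  "flag_weight \<omega> Fs = (\<Prod>i < length Fs - 1. \<omega> (Fs ! i) (Fs ! Suc i))"

text \<open>The sign \<open>s = \<plusminus>1\<close> selects the cone using \<open>e\<^sub>E\<close> or its copy using \<open>-e\<^sub>E\<close>.\<close>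

definition flag_cone :: "real \<Rightarrow> 'e::finite set list \<Rightarrow> (real ^ 'e) set" where
  "flag_cone s Fs =
     convex_cone hull (char_vec ` (set Fs - {UNIV}) \<union> {s *\<^sub>R char_vec UNIV})"

text \<open>\<open>X\<close> is the \<open>k\<close>-dimensional Flag fan corresponding to the pair \<open>((\<G>, R), \<omega>)\<close>.\<close>

definition flag_fan_of ::
    "nat \<Rightarrow> 'e::finite set set \<Rightarrow> ('e set \<times> 'e set) set \<Rightarrow> ('e set \<Rightarrow> 'e set \<Rightarrow> int) \<Rightarrow>
     (real ^ 'e) weighted_fan \<Rightarrow> bool" where
  "flag_fan_of k \<G> R \<omega> X \<longleftrightarrow>
     ranked_set_poset \<G> R \<and>
     tropical_fan k X \<and>
     cones X = {flag_cone s Fs | s Fs. s \<in> {1, -1} \<and> maximal_flag R Fs} \<and>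
     (\<forall>s Fs. s \<in> {1, -1} \<and> maximal_flag R Fs \<longrightarrow>
        weight X (flag_cone s Fs) = of_int (flag_weight \<omega> Fs))"

definition is_flag_fan :: "nat \<Rightarrow> (real ^ 'e::finite) weighted_fan \<Rightarrow> bool" where
  "is_flag_fan k Y \<longleftrightarrow> (\<exists>\<G> R \<omega> Z. flag_fan_of k \<G> R \<omega> Z \<and> same_fan Y Z)"

text \<open>In a cut, upward closedness refers to inclusion of sets, not to the order of \<open>\<G>\<close>.\<close>

definition is_cut :: "'e set set \<Rightarrow> 'e set set \<Rightarrow> bool" where
  "is_cut \<G> \<A> \<longleftrightarrow> \<A> \<subseteq> \<G> \<and> (\<forall>F \<in> \<A>. \<forall>F' \<in> \<G>. F \<subseteq> F' \<longrightarrow> F' \<in> \<A>)"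

text \<open>
  The values are prescribed on the rays \<open>e\<^sub>F\<close>, \<open>F \<noteq> {}\<close>. The vector \<open>e\<^sub>F\<close> for \<open>F = {}\<close> is
  zero, where a conewise linear function vanishes anyway; excluding it keeps the cut \<open>\<A> = \<G>\<close>
  meaningful.
\<close>

definition cut_function ::
    "(real ^ 'e::finite) weighted_fan \<Rightarrow> 'e set set \<Rightarrow> 'e set set \<Rightarrow> (real ^ 'e \<Rightarrow> real) \<Rightarrow> bool" where
  "cut_function X \<G> \<A> \<phi> \<longleftrightarrow>
     rational_function X \<phi> \<and>
     (\<forall>F \<in> \<G>. F \<noteq> {} \<longrightarrow> \<phi> (char_vec F) = (if F \<in> \<A> then -1 else 0)) \<and>
     \<phi> (- char_vec UNIV) = - \<phi> (char_vec UNIV)"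

end

theory Submission
  imports Defs
begin

text \<open>
  A cone of the divisor arises from a maximal flag of \<open>\<G>\<close> by deleting one element between
  consecutive \<open>F\<close> and \<open>F'\<close> (deleting the ray \<open>\<plusminus>e\<^sub>E\<close> gives weight zero, as the
  two signs cancel). Its weight vanishes unless \<open>F\<close> lies outside the cut and \<open>F'\<close> inside, and then,
  up to the weights of the remaining edges, it depends only on \<open>F\<close> and \<open>F'\<close>. Hence the divisor is
  the Flag fan of a new order on \<open>\<G>\<close>: the covering relations on either side of the cut are kept, and
  \<open>F\<close> outside is covered by \<open>F'\<close> inside if two steps lead from \<open>F\<close> to \<open>F'\<close>. This order is ranked
  because all ranks outside the cut are raised by one. Balancing of the divisor is inherited
  except around an interval of rank three crossing the cut, where it is a double counting of the
  flags of that interval.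
\<close>

text \<open>A tropical fan shows only the products of edge weights along whole flags. So balancing
  of \<open>X\<close> constrains the edges between \<open>F\<close> and \<open>F'\<close> only if
  chains of nonzero weight lead from \<open>{}\<close> to \<open>F\<close> and from
  \<open>F'\<close> to \<open>UNIV\<close>. Hence the predicate \<open>supported\<close>, and hence
  the need to show that a chain supported in the divisor can be refilled to one supported in
  \<open>X\<close>. The weight of a new edge originates as follows. Vectors in the span of a flag
  with a gap are constant on \<open>F' - F\<close>. Balancing therefore forces the sum of c_G e_G
  over the sets G filling the gap to be (W - D) e_F + D e_F', where W is the sum of the c_G and D is
  the common coordinate. If \<open>F'\<close> lies in the cut and \<open>F\<close> does not, the
  divisor formula yields D minus the sum of the c_G over the G in the cut; with the factors of the
  remaining edges taken out, this is \<open>jump_weight\<close>. Primitive vectors are arbitrary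
  choices, but the generators of a flag cone are part of a lattice basis. So each choice agrees with
  a characteristic vector modulo the span of the facet, and the difference cancels in the divisor
  formula.\<close>

section \<open>Unimodular cones\<close>

text \<open>
  The dual functionals are required to be integral on the whole lattice, so \<open>S\<close> is part of a
  lattice basis.
\<close>

definition unimodular :: "(real ^ 'n::finite) set \<Rightarrow> bool" where
  "unimodular S \<longleftrightarrow> finite S \<and> S \<subseteq> int_lattice \<and>
     (\<forall>g\<in>S. \<exists>f::real ^ 'n \<Rightarrow> real. linear f \<and> f g = 1 \<and> (\<forall>h\<in>S - {g}. f h = 0) \<and>
        (\<forall>x\<in>int_lattice. f x \<in> \<int>))"

lemma unimodular_subset:
  assumes "unimodular S" "T \<subseteq> S"
  shows "unimodular T"
  unfolding unimodular_def
proof (intro conjI ballI)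
  show "finite T" "T \<subseteq> int_lattice"
    using assms finite_subset unfolding unimodular_def by blast+
  fix g assume "g \<in> T"
  with assms obtain f :: "real^'a \<Rightarrow> real"
    where "linear f" "f g = 1" "\<forall>h\<in>S - {g}. f h = 0" "\<forall>x\<in>int_lattice. f x \<in> \<int>"
    unfolding unimodular_def by (meson subsetD)
  with assms(2) show "\<exists>f::real^'a \<Rightarrow> real. linear f \<and> f g = 1 \<and> (\<forall>h\<in>T - {g}. f h = 0) \<and>
      (\<forall>x\<in>int_lattice. f x \<in> \<int>)"
    by (intro exI[of _ f]) auto
qed

lemma unimodular_dual:
  fixes S :: "(real ^ 'n::finite) set"
  assumes "unimodular S"
  obtains f :: "real ^ 'n \<Rightarrow> real ^ 'n \<Rightarrow> real" where
    "\<And>g. g \<in> S \<Longrightarrow> linear (f g)" "\<And>g h. g \<in> S \<Longrightarrow> h \<in> S \<Longrightarrow> f g h = of_bool (h = g)"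
    "\<And>g x. g \<in> S \<Longrightarrow> x \<in> int_lattice \<Longrightarrow> f g x \<in> \<int>"
proof -
  have "\<forall>g\<in>S. \<exists>f::real^'n \<Rightarrow> real. linear f \<and> (\<forall>h\<in>S. f h = of_bool (h = g)) \<and>
      (\<forall>x\<in>int_lattice. f x \<in> \<int>)"
  proof
    fix g assume "g \<in> S"
    with assms obtain f :: "real^'n \<Rightarrow> real"
      where "linear f" "f g = 1" "\<forall>h\<in>S - {g}. f h = 0" "\<forall>x\<in>int_lattice. f x \<in> \<int>"
      unfolding unimodular_def by meson
    then show "\<exists>f::real^'n \<Rightarrow> real. linear f \<and> (\<forall>h\<in>S. f h = of_bool (h = g)) \<and>
        (\<forall>x\<in>int_lattice. f x \<in> \<int>)"
      by (intro exI[of _ f]) auto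
  qed
  then show thesis
    using that bchoice[of S "\<lambda>g f. linear f \<and> (\<forall>h\<in>S. f h = of_bool (h = g)) \<and>
      (\<forall>x\<in>int_lattice. f x \<in> \<int>)"] by blast
qed

lemma convex_cone_sum:
  assumes "convex_cone C" "\<And>x. x \<in> A \<Longrightarrow> f x \<in> C"
  shows "sum f A \<in> C"
  using assms(2)
  by (induction A rule: infinite_finite_induct)
    (auto simp: convex_cone_contains_0[OF assms(1)] convex_cone_add[OF assms(1)])

lemma convex_cone_hull_finite:
  fixes S :: "'a::real_vector set"
  assumes "finite S"
  shows "convex_cone hull S = {\<Sum>g\<in>S. c g *\<^sub>R g |c. \<forall>g\<in>S. (0::real) \<le> c g}" (is "_ = ?K")
proof
  show "convex_cone hull S \<subseteq> ?K"
  proof (rule hull_minimal)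
    show "S \<subseteq> ?K"
    proof
      fix x assume "x \<in> S"
      have "x = (\<Sum>g\<in>S. (if g = x then 1 else 0) *\<^sub>R g)"
        using assms \<open>x \<in> S\<close> by (simp add: if_distrib[of "\<lambda>c. c *\<^sub>R _"] sum.delta cong: if_cong)
      then show "x \<in> ?K" by (auto intro!: exI[of _ "\<lambda>g. if g = x then 1 else 0"])
    qed
    have "(0::'a) \<in> ?K" by (auto intro!: exI[of _ "\<lambda>_. 0"])
    moreover have "x + y \<in> ?K" if "x \<in> ?K" "y \<in> ?K" for x y
    proof -
      from that obtain c d where "x = (\<Sum>g\<in>S. c g *\<^sub>R g)" "\<forall>g\<in>S. 0 \<le> c g"
        "y = (\<Sum>g\<in>S. d g *\<^sub>R g)" "\<forall>g\<in>S. 0 \<le> d g" by blast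
      then show ?thesis
        by (auto intro!: exI[of _ "\<lambda>g. c g + d g"] simp: sum.distrib scaleR_add_left)
    qed
    moreover have "t *\<^sub>R x \<in> ?K" if "x \<in> ?K" "0 \<le> t" for x t
    proof -
      from that obtain c where "x = (\<Sum>g\<in>S. c g *\<^sub>R g)" "\<forall>g\<in>S. 0 \<le> c g" by blast
      with that show ?thesis
        by (auto intro!: exI[of _ "\<lambda>g. t * c g"] simp: scaleR_sum_right)
    qed
    ultimately show "convex_cone ?K" by (simp add: convex_cone_iff)
  qed
  show "?K \<subseteq> convex_cone hull S"
  proof clarify
    fix c assume "\<forall>g\<in>S. (0::real) \<le> c g"
    then show "(\<Sum>g\<in>S. c g *\<^sub>R g) \<in> convex_cone hull S"
      by (intro convex_cone_sum convex_cone_convex_cone_hull convex_cone_hull_mul hull_inc) auto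
  qed
qed

lemma convex_cone_hull_subset_span: "convex_cone hull S \<subseteq> span S"
  by (rule hull_minimal) (auto simp: span_superset convex_cone_iff span_add span_scale span_zero)

lemma span_convex_cone_hull [simp]: "span (convex_cone hull S) = span S"
  by (meson convex_cone_hull_subset_span hull_subset span_eq subset_trans span_superset)

section \<open>Dimension, coordinates and faces of unimodular cones\<close>

lemma unimodular_independent:
  assumes "unimodular S"
  shows "independent S"
proof
  obtain f where f: "\<And>g. g \<in> S \<Longrightarrow> linear (f g :: _ \<Rightarrow> real)"
    "\<And>g h. g \<in> S \<Longrightarrow> h \<in> S \<Longrightarrow> f g h = of_bool (h = g)"
    "\<And>g x. g \<in> S \<Longrightarrow> x \<in> int_lattice \<Longrightarrow> f g x \<in> \<int>"
    by (rule unimodular_dual[OF assms]) (rule that)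
  assume "dependent S"
  then obtain g where g: "g \<in> S" "g \<in> span (S - {g})"
    unfolding dependent_def by blast
  have "f g g = 0"
    using linear_eq_0_on_span[OF f(1)[OF g(1)] _ g(2)] f(2) g(1) by auto
  with f(2) g(1) show False by simp
qed

lemma dim_unimodular_cone:
  assumes "unimodular S"
  shows "dim (convex_cone hull S) = card S"
  by (metis assms dim_span span_convex_cone_hull unimodular_independent dim_eq_card_independent)

text \<open>Describes the cones over all subsets \<open>T\<close> in the same coordinates, those
  dual to \<open>S\<close>, so that a cone and its faces can be compared by signs and zeros.\<close>

lemma unimodular_cone_coords:
  assumes "unimodular S" "T \<subseteq> S"
    and f: "\<And>g. g \<in> S \<Longrightarrow> linear (f g :: _ \<Rightarrow> real)"
      "\<And>g h. g \<in> S \<Longrightarrow> h \<in> S \<Longrightarrow> f g h = of_bool (h = g)"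
  shows "x \<in> convex_cone hull T \<longleftrightarrow>
    x = (\<Sum>g\<in>S. f g x *\<^sub>R g) \<and> (\<forall>g\<in>S. 0 \<le> f g x) \<and> (\<forall>g\<in>S - T. f g x = 0)" (is "_ = ?R")
proof
  have fin: "finite S" "finite T"
    using assms(1,2) finite_subset unfolding unimodular_def by blast+
  assume "x \<in> convex_cone hull T"
  then obtain c where c: "x = (\<Sum>h\<in>T. c h *\<^sub>R h)" "\<forall>h\<in>T. 0 \<le> c h"
    unfolding convex_cone_hull_finite[OF fin(2)] by blast
  have fx: "f g x = (if g \<in> T then c g else 0)" if "g \<in> S" for g
  proof -
    have "f g x = (\<Sum>h\<in>T. c h * f g h)"
      using f(1)[OF that] by (simp add: c(1) linear_sum linear_scale)
    also have "\<dots> = (\<Sum>h\<in>T. if h = g then c h else 0)"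
      using that assms(2) by (intro sum.cong) (auto simp: f(2))
    finally show ?thesis using fin by simp
  qed
  have "x = (\<Sum>g\<in>T. f g x *\<^sub>R g)"
    unfolding c(1) using assms(2) fx c(1) by (intro sum.cong) auto
  also have "\<dots> = (\<Sum>g\<in>S. f g x *\<^sub>R g)"
    using fin assms(2) fx by (intro sum.mono_neutral_left) auto
  finally show ?R using fx c(2) by auto
next
  have fin: "finite S" using assms(1) unfolding unimodular_def by blast
  assume R: ?R
  then have "x = (\<Sum>g\<in>T. f g x *\<^sub>R g)"
    using fin assms(2) sum.mono_neutral_right[of S T "\<lambda>g. f g x *\<^sub>R g"] by auto
  moreover have "(\<Sum>g\<in>T. f g x *\<^sub>R g) \<in> convex_cone hull T"
    using R assms(2)
    by (intro convex_cone_sum convex_cone_convex_cone_hull convex_cone_hull_mul hull_inc) auto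
  ultimately show "x \<in> convex_cone hull T" by simp
qed

text \<open>A coordinate outside \<open>T\<close> is nonnegative on the whole cone. If it vanishes
  at an interior point of a segment, it vanishes at both ends.\<close>

lemma unimodular_face:
  assumes "unimodular S" "T \<subseteq> S"
  shows "convex_cone hull T face_of convex_cone hull S"
proof -
  obtain f where f: "\<And>g. g \<in> S \<Longrightarrow> linear (f g :: _ \<Rightarrow> real)"
    "\<And>g h. g \<in> S \<Longrightarrow> h \<in> S \<Longrightarrow> f g h = of_bool (h = g)"
    "\<And>g x. g \<in> S \<Longrightarrow> x \<in> int_lattice \<Longrightarrow> f g x \<in> \<int>"
    by (rule unimodular_dual[OF assms(1)]) (rule that)
  note coords = unimodular_cone_coords[OF assms(1) _ f(1,2)]
  show ?thesis
    unfolding face_of_def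
  proof (intro conjI ballI impI)
    show "convex_cone hull T \<subseteq> convex_cone hull S" using assms(2) by (rule hull_mono)
    show "convex (convex_cone hull T)" by (rule convex_convex_cone_hull)
    fix a b x assume ab: "a \<in> convex_cone hull S" "b \<in> convex_cone hull S"
      and x: "x \<in> convex_cone hull T" "x \<in> open_segment a b"
    then obtain u where u: "0 < u" "u < 1" "x = (1 - u) *\<^sub>R a + u *\<^sub>R b"
      unfolding in_segment by blast
    have "f g a = 0 \<and> f g b = 0" if "g \<in> S - T" for g
    proof -
      have "0 \<le> f g a" "0 \<le> f g b" using ab that coords[OF subset_refl] by auto
      moreover have "(1 - u) * f g a + u * f g b = f g x"
        using f(1)[of g] that by (simp add: u(3) linear_add linear_scale)
      moreover have "f g x = 0" using x(1) that coords[OF assms(2)] by blast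
      ultimately show ?thesis using u(1,2)
        by (smt (verit) mult_pos_pos mult_nonneg_nonneg)
    qed
    then show "a \<in> convex_cone hull T" "b \<in> convex_cone hull T"
      using ab coords[OF subset_refl] coords[OF assms(2)] by auto
  qed
qed

text \<open>\<open>face_of\<close> speaks about open segments. The sum of \<open>a\<close> and
  \<open>b\<close> is the midpoint of their doubles, so the double of \<open>a\<close> lies in the
  face; halving it requires 0 in the face as well.\<close>

lemma face_of_convex_cone_summand:
  assumes "convex_cone C" "F face_of C" "a \<in> C" "b \<in> C" "a + b \<in> F"
  shows "a \<in> F"
proof -
  have "0 \<in> C" using assms(1) by (rule convex_cone_contains_0)
  have 2: "2 *\<^sub>R a \<in> C" "2 *\<^sub>R b \<in> C"
    using assms by (auto intro: convex_cone_scaleR)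
  have mid: "a + b = (1 - 1/2) *\<^sub>R (2 *\<^sub>R a) + (1/2) *\<^sub>R (2 *\<^sub>R b)" by (simp add: scaleR_add_right)
  have F2: "2 *\<^sub>R a \<in> F"
  \<comment> \<open>The open segment is empty for \<open>a = b\<close>, hence the separate
    case.\<close>
  proof (cases "a = b")
    case True then show ?thesis using assms(5) by (simp add: scaleR_2)
  next
    case False
    then have "a + b \<in> open_segment (2 *\<^sub>R a) (2 *\<^sub>R b)"
      unfolding in_segment using mid by (intro conjI exI[of _ "1/2"]) auto
    then show ?thesis using face_ofD[OF assms(2)] 2 assms(5) by blast
  qed
  show ?thesis
  proof (cases "a = 0")
    case True then show ?thesis using F2 by simp
  next
    case False
    \<comment> \<open>A second segment, with the double of \<open>a\<close> as midpoint, brings 0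
      into the face.\<close>
    have "2 *\<^sub>R a \<in> open_segment 0 (4 *\<^sub>R a)"
      unfolding in_segment using False by (intro conjI exI[of _ "1/2"]) auto
    moreover have "4 *\<^sub>R a \<in> C" using assms by (auto intro: convex_cone_scaleR)
    ultimately have "0 \<in> F" using face_ofD[OF assms(2)] \<open>0 \<in> C\<close> F2 by blast
    moreover have "convex F" using assms(2) by (rule face_of_imp_convex)
    ultimately have "(1/2) *\<^sub>R 0 + (1/2) *\<^sub>R (2 *\<^sub>R a) \<in> F" using F2 
      by (intro convexD) auto
    then show ?thesis by simp
  qed
qed

text \<open>A face is generated by the generators that it contains. Once the face is known to be a
  convex cone, every term in the expansion of one of its points is a summand of that point, hence
  lies in the face, and rescaling the term gives the generator itself. The empty set is also a face
  and has to be excluded.\<close>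

lemma unimodular_faceD:
  assumes "unimodular S" "F face_of convex_cone hull S" "F \<noteq> {}"
  obtains T where "T \<subseteq> S" "F = convex_cone hull T"
proof
  define T where "T = S \<inter> F"
  show "T \<subseteq> S" by (simp add: T_def)
  have fin: "finite S" using assms(1) unfolding unimodular_def by blast
  note hull = convex_cone_convex_cone_hull[of S]
  have conicF: "convex_cone F"
  proof -
    obtain x where x: "x \<in> F" using assms(3) by blast
    have sub: "F \<subseteq> convex_cone hull S" using assms(2) by (rule face_of_imp_subset)
    have "0 \<in> F"
      using face_of_convex_cone_summand[OF hull assms(2), of 0 x] x sub convex_cone_contains_0[OF hull]
      by auto
    have mul: "t *\<^sub>R y \<in> F" if "y \<in> F" "0 \<le> t" for y t
    proof -
      \<comment> \<open>Integer multiples come first, because \<open>y\<close> lies strictly between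
        0 and a larger multiple of itself.\<close>
      have "t *\<^sub>R y \<in> F" if "y \<in> F" for y and t :: nat
        using that
      proof (induction t)
        case (Suc t)
        show ?case
        proof (cases "t = 0 \<or> y = 0")
          case False
          have "y \<in> open_segment 0 ((1 + real t) *\<^sub>R y)"
            unfolding in_segment using False
            by (intro conjI exI[of _ "1 / (1 + real t)"]) (auto simp: divide_simps)
          moreover have "(1 + real t) *\<^sub>R y \<in> convex_cone hull S"
            using Suc.prems sub by (auto intro: convex_cone_scaleR[OF hull])
          ultimately show ?thesis
            using face_ofD[OF assms(2)] \<open>0 \<in> F\<close> sub Suc.prems by auto
        qed (use Suc.prems \<open>0 \<in> F\<close> in auto)
      qed (use \<open>0 \<in> F\<close> in auto)
      \<comment> \<open>A real multiple is a summand of the multiple by the rounded-up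
        factor.\<close>
      from this[OF that(1), of "nat \<lceil>t\<rceil>"]
      have "t *\<^sub>R y + (real (nat \<lceil>t\<rceil>) - t) *\<^sub>R y \<in> F"
        by (simp flip: scaleR_add_left)
      moreover have "real (nat \<lceil>t\<rceil>) - t \<ge> 0" using that(2) by linarith
      ultimately show ?thesis
        using face_of_convex_cone_summand[OF hull assms(2)] that sub
        by (meson convex_cone_scaleR[OF hull] subsetD)
    qed
    have "y + z \<in> F" if "y \<in> F" "z \<in> F" for y z
    proof -
      have "(1/2) *\<^sub>R y + (1/2) *\<^sub>R z \<in> F"
        using face_of_imp_convex[OF assms(2)] that by (intro convexD) auto
      from mul[OF this, of 2] show ?thesis by (simp add: scaleR_add_right)
    qed
    with mul \<open>0 \<in> F\<close> show ?thesis by (simp add: convex_cone_iff)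
  qed
  show "F = convex_cone hull T"
  proof
    show "convex_cone hull T \<subseteq> F"
      by (rule hull_minimal) (auto simp: T_def conicF)
    show "F \<subseteq> convex_cone hull T"
    proof
      fix x assume x: "x \<in> F"
      then have "x \<in> convex_cone hull S" using face_of_imp_subset[OF assms(2)] by blast
      then obtain c where c: "x = (\<Sum>g\<in>S. c g *\<^sub>R g)" "\<forall>g\<in>S. 0 \<le> c g"
        unfolding convex_cone_hull_finite[OF fin] by blast
      have in_hull: "c g *\<^sub>R g \<in> convex_cone hull S" if "g \<in> S" for g
        using that c(2) by (simp add: convex_cone_hull_mul hull_inc)
      have "c g *\<^sub>R g \<in> convex_cone hull T" if g: "g \<in> S" for g
      proof (cases "c g = 0")
        case True then show ?thesis by (simp add: convex_cone_hull_contains_0)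
      next
        case False
        have "x = c g *\<^sub>R g + (\<Sum>h\<in>S - {g}. c h *\<^sub>R h)"
          unfolding c(1) using fin g by (rule sum.remove)
        moreover have "(\<Sum>h\<in>S - {g}. c h *\<^sub>R h) \<in> convex_cone hull S"
          using in_hull by (intro convex_cone_sum hull) auto
        ultimately have "c g *\<^sub>R g \<in> F"
          using face_of_convex_cone_summand[OF hull assms(2) in_hull[OF g]] x by metis
        then have "(1 / c g) *\<^sub>R (c g *\<^sub>R g) \<in> F"
          using c(2) g by (intro convex_cone_scaleR[OF conicF, of "1 / c g"]) simp_all
        then have "g \<in> T" using False g by (simp add: T_def)
        then show ?thesis using c(2) g by (simp add: convex_cone_hull_mul hull_inc)
      qed
      then show "x \<in> convex_cone hull T"
        unfolding c(1) by (intro convex_cone_sum convex_cone_convex_cone_hull) auto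
    qed
  qed
qed

text \<open>The cones contain 0, so their affine dimension is their linear one, which counts
  generators. A face of codimension one therefore lacks exactly one generator.\<close>

lemma unimodular_facet_iff:
  assumes "unimodular S"
  shows "\<tau> facet_of convex_cone hull S \<longleftrightarrow> (\<exists>g\<in>S. \<tau> = convex_cone hull (S - {g}))"
proof -
  have fin: "finite S" using assms unfolding unimodular_def by blast
  have aff: "aff_dim (convex_cone hull T) = int (card T)" if "T \<subseteq> S" for T
    using dim_unimodular_cone[OF unimodular_subset[OF assms that]] convex_cone_hull_contains_0
    by (metis aff_dim_zero hull_inc)
  show ?thesis
  proof
    assume "\<tau> facet_of convex_cone hull S"
    then have \<tau>: "\<tau> face_of convex_cone hull S" "\<tau> \<noteq> {}"
      "aff_dim \<tau> = aff_dim (convex_cone hull S) - 1" unfolding facet_of_def by auto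
    obtain T where T: "T \<subseteq> S" "\<tau> = convex_cone hull T"
      using unimodular_faceD[OF assms \<tau>(1,2)] by blast
    have "card T + 1 = card S" using \<tau>(3) aff[OF T(1)] aff[OF subset_refl] T(2) by simp
    then have "card (S - T) = 1" using T(1) fin by (simp add: card_Diff_subset finite_subset)
    then obtain g where "S - T = {g}" by (auto simp: card_1_singleton_iff)
    with T show "\<exists>g\<in>S. \<tau> = convex_cone hull (S - {g})"
      by (metis Diff_Diff_Int Diff_subset insert_subset inf.absorb_iff2)
  next
    assume "\<exists>g\<in>S. \<tau> = convex_cone hull (S - {g})"
    then obtain g where g: "g \<in> S" "\<tau> = convex_cone hull (S - {g})" by blast
    have "card S \<noteq> 0" using g fin by auto
    then have "aff_dim \<tau> = aff_dim (convex_cone hull S) - 1"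
      using g fin aff[of S] aff[of "S - {g}"] by (simp add: card_Diff_singleton of_nat_diff Suc_leI card_gt_0_iff)
    then show "\<tau> facet_of convex_cone hull S"
      unfolding facet_of_def using unimodular_face[OF assms, of "S - {g}"] g convex_cone_hull_nonempty
      by auto
  qed
qed

text \<open>The generators are recovered from the cone as the primitive vectors on its rays. The ray
  of \<open>g\<close> is a one-dimensional face, hence also the ray of some \<open>h\<close> in the
  other set; integrality of the dual functionals then forces the two to coincide.\<close>

lemma unimodular_hull_inject:
  assumes "unimodular S" "unimodular T" "convex_cone hull S = convex_cone hull T"
  shows "S = T"
proof -
  have "S \<subseteq> T" if ST: "unimodular S" "unimodular T" "convex_cone hull S = convex_cone hull T"
    for S T :: "(real^'a) set"
  proof
    fix g assume g: "g \<in> S"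
    obtain f where f: "\<And>g. g \<in> S \<Longrightarrow> linear (f g :: _ \<Rightarrow> real)"
      "\<And>g h. g \<in> S \<Longrightarrow> h \<in> S \<Longrightarrow> f g h = of_bool (h = g)"
      "\<And>g x. g \<in> S \<Longrightarrow> x \<in> int_lattice \<Longrightarrow> f g x \<in> \<int>"
      by (rule unimodular_dual[OF ST(1)]) (rule that)
    obtain f' where f': "\<And>g. g \<in> T \<Longrightarrow> linear (f' g :: _ \<Rightarrow> real)"
      "\<And>g h. g \<in> T \<Longrightarrow> h \<in> T \<Longrightarrow> f' g h = of_bool (h = g)"
      "\<And>g x. g \<in> T \<Longrightarrow> x \<in> int_lattice \<Longrightarrow> f' g x \<in> \<int>"
      by (rule unimodular_dual[OF ST(2)]) (rule that)
    have "convex_cone hull {g} face_of convex_cone hull T"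
      using unimodular_face[OF ST(1), of "{g}"] g ST(3) by simp
    then obtain U where U: "U \<subseteq> T" "convex_cone hull {g} = convex_cone hull U"
      using unimodular_faceD[OF ST(2)] convex_cone_hull_nonempty by metis
    have "card U = 1"
      using dim_unimodular_cone[OF unimodular_subset[OF ST(1), of "{g}"]]
        dim_unimodular_cone[OF unimodular_subset[OF ST(2) U(1)]] g U(2) by simp
    then obtain h where h: "U = {h}" by (auto simp: card_1_singleton_iff)
    then have "h \<in> T" using U by simp
    have "g \<in> convex_cone hull {h}" using hull_inc[of g "{g}" convex_cone] U(2) h by simp
    then obtain c where c: "g = c *\<^sub>R h" "0 \<le> c" by (auto simp: convex_cone_hull_finite)
    \<comment> \<open>Both \<open>f' h g\<close>, which is \<open>c\<close>, and
      \<open>f g h\<close>, which is the inverse of \<open>c\<close>, are integers, so the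
      nonnegative number \<open>c\<close> is 1.\<close>
    have "f' h g = c"
      using linear_scale[OF f'(1)[OF \<open>h \<in> T\<close>], of c h] c(1) f'(2) \<open>h \<in> T\<close> by simp
    moreover have "1 = c * f g h"
      using linear_scale[OF f(1)[OF g], of c h] c(1) f(2) g by simp
    moreover have "f' h g \<in> \<int>" "f g h \<in> \<int>"
      using f(3) f'(3) g \<open>h \<in> T\<close> ST(1,2) unfolding unimodular_def by blast+
    ultimately have "c = 1"
      using c(2) by (elim Ints_cases) (smt (verit) mult_cancel_left1 of_int_0_le_iff of_int_1
        of_int_eq_iff of_int_mult pos_zmult_eq_1_iff zero_less_one of_int_0)
    with c(1) \<open>h \<in> T\<close> show "g \<in> T" by simp
  qed
  with assms show ?thesis by blast
qed

text \<open>The generator \<open>g\<close> is itself a primitive representative, so the choice in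
  \<open>primitive_vec\<close> is meaningful. For the chosen vector, the functional dual to
  \<open>g\<close> takes an integer value that divides 1 and is nonnegative because the vector
  points into the cone; so the value is 1, as it is at \<open>g\<close>.\<close>

lemma primitive_vec_unimodular:
  assumes "unimodular S" "g \<in> S"
  shows "primitive_vec (convex_cone hull S) (convex_cone hull (S - {g})) - g \<in> span (S - {g})"
proof -
  from assms obtain f :: "real^'a \<Rightarrow> real"
    where f: "linear f" "f g = 1" "\<forall>h\<in>S - {g}. f h = 0" "\<forall>x\<in>int_lattice. f x \<in> \<int>"
    unfolding unimodular_def by meson
  have gl: "g \<in> int_lattice" using assms unfolding unimodular_def by blast
  have ker: "f x = 0" if "x \<in> span (S - {g})" for x
    using linear_eq_0_on_span[OF f(1) _ that] f(3) by blast
  have split: "x - f x *\<^sub>R g \<in> span (S - {g})" if "x \<in> span S" for x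
  proof -
    have "x \<in> span (insert g (S - {g}))" using that assms(2) by (simp add: insert_absorb)
    then obtain c where c: "x - c *\<^sub>R g \<in> span (S - {g})" using span_breakdown_eq by blast
    have "f x = c" using ker[OF c] f(1,2) by (simp add: linear_diff linear_scale)
    with c show ?thesis by simp
  qed
  have "primitive_rep (convex_cone hull S) (convex_cone hull (S - {g})) g"
    unfolding primitive_rep_def
  proof (intro conjI ballI)
    show "g \<in> span (convex_cone hull S) \<inter> int_lattice"
      using gl assms(2) by (simp add: span_base)
    show "\<exists>w\<in>span (convex_cone hull (S - {g})). g + w \<in> convex_cone hull S"
      using assms(2) by (intro bexI[of _ 0]) (auto simp: hull_inc span_zero)
    fix x assume x: "x \<in> span (convex_cone hull S) \<inter> int_lattice"
    then obtain m where m: "f x = of_int m" using f(4) Ints_cases by blast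
    have "x - of_int m *\<^sub>R g \<in> int_lattice"
      using x gl unfolding int_lattice_def by (auto intro!: Ints_diff Ints_mult)
    then show "\<exists>m. \<exists>w\<in>span (convex_cone hull (S - {g})) \<inter> int_lattice. x = of_int m *\<^sub>R g + w"
      using split[of x] x m
      by (intro exI[of _ m] bexI[of _ "x - of_int m *\<^sub>R g"]) auto
  qed
  then have "primitive_rep (convex_cone hull S) (convex_cone hull (S - {g}))
      (primitive_vec (convex_cone hull S) (convex_cone hull (S - {g})))" (is "primitive_rep _ _ ?v")
    unfolding primitive_vec_def by (rule someI)
  then have v: "?v \<in> span S" "?v \<in> int_lattice" 
    "\<exists>m::int. \<exists>w \<in> span (S - {g}). g = of_int m *\<^sub>R ?v + w"
    "\<exists>w\<in>span (S - {g}). ?v + w \<in> convex_cone hull S"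
    using gl assms(2) unfolding primitive_rep_def span_convex_cone_hull
    by (blast, blast, meson IntI IntD1 span_base, blast)
  obtain m w where mw: "g = of_int m *\<^sub>R ?v + w" "w \<in> span (S - {g})" using v(3) by blast
  have "f g = of_int m * f ?v + f w"
    using f(1) by (subst mw(1)) (simp add: linear_add linear_scale)
  then have 1: "of_int m * f ?v = 1" using ker[OF mw(2)] f(2) by simp
  have "convex_cone hull S \<subseteq> {x. 0 \<le> f x}"
  proof (rule hull_minimal)
    show "S \<subseteq> {x. 0 \<le> f x}" using f(2,3) by (metis DiffI dual_order.refl mem_Collect_eq singletonD subsetI zero_le_one)
    show "convex_cone {x. 0 \<le> f x}"
      using f(1) by (auto simp: convex_cone_iff linear_add linear_scale linear_0)
  qed
  then have "0 \<le> f ?v" using v(4) ker f(1) by (auto simp: linear_add subset_iff)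
  moreover obtain n where n: "f ?v = of_int n" using v(2) f(4) Ints_cases by blast
  ultimately have "m * n = 1" "0 \<le> n"
    using 1 by (metis of_int_1 of_int_eq_iff of_int_mult, metis of_int_0_le_iff)
  then have "n = 1" by (metis dual_order.antisym mult_zero_right pos_zmult_eq_1_iff zero_le_mult_iff zero_less_one not_one_le_zero order_less_le mult.commute)
  then show ?thesis using split[OF v(1)] n by simp
qed

section \<open>Flags and their cones\<close>

lemma char_vec_nth [simp]: "char_vec F $ i = of_bool (i \<in> F)"
  by (simp add: char_vec_def indicator_def)

lemma char_vec_eq_iff [simp]: "char_vec F = char_vec G \<longleftrightarrow> F = G"
  by (auto simp: vec_eq_iff)

lemma char_vec_empty: "char_vec {} = 0"
  by (simp add: vec_eq_iff)

lemma char_vec_eq_signed_UNIV: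
  assumes "s \<in> {1, -1}"
  shows "char_vec F = s *\<^sub>R char_vec (UNIV :: 'e::finite set) \<longleftrightarrow> s = 1 \<and> F = UNIV"
  using assms by (auto simp: vec_eq_iff)

lemma signed_UNIV_notin_image:
  assumes "s \<in> {1, -1}"
  shows "s *\<^sub>R char_vec UNIV \<notin> char_vec ` (C - {{}, UNIV :: 'e::finite set})"
  using char_vec_eq_signed_UNIV[OF assms, where ?'e = 'e] by (metis DiffD2 imageE insertI1 insertI2)

text \<open>A linearly independent version of the generators in \<open>flag_cone\<close>: the empty
  set would contribute the zero vector, and \<open>UNIV\<close> enters only through the signed
  ray.\<close>

definition flag_gens :: "real \<Rightarrow> 'e::finite set set \<Rightarrow> (real ^ 'e) set" where
  "flag_gens s C = insert (s *\<^sub>R char_vec UNIV) (char_vec ` (C - {{}, UNIV}))"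

lemma flag_cone_eq_hull: "flag_cone s Fs = convex_cone hull flag_gens s (set Fs)"
proof
  let ?C = "char_vec ` (set Fs - {UNIV}) \<union> {s *\<^sub>R char_vec UNIV}"
  have "flag_gens s (set Fs) \<subseteq> ?C" unfolding flag_gens_def by auto
  then show "convex_cone hull flag_gens s (set Fs) \<subseteq> flag_cone s Fs"
    unfolding flag_cone_def by (rule hull_mono)
  have "char_vec F \<in> convex_cone hull flag_gens s (set Fs)" if "F \<in> set Fs - {UNIV}" for F
    using that convex_cone_hull_contains_0[of "flag_gens s (set Fs)"]
    by (cases "F = {}") (auto simp: char_vec_empty flag_gens_def intro: hull_inc)
  moreover have "s *\<^sub>R char_vec UNIV \<in> convex_cone hull flag_gens s (set Fs)"
    unfolding flag_gens_def by (simp add: hull_inc)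
  ultimately have "?C \<subseteq> convex_cone hull flag_gens s (set Fs)"
    by blast
  then show "flag_cone s Fs \<subseteq> convex_cone hull flag_gens s (set Fs)"
    unfolding flag_cone_def by (rule hull_minimal) (rule convex_cone_convex_cone_hull)
qed

text \<open>A nonempty finite chain contains its union, so the union of proper subsets of
  \<open>G\<close> is still a proper subset of \<open>G\<close>.\<close>

lemma chain_separate_below:
  fixes C :: "'e::finite set set"
  assumes "chain\<^sub>\<subseteq> C" "\<And>H. H \<in> C \<Longrightarrow> H \<subset> G" "G \<noteq> {}"
  obtains e where "e \<in> G" "\<And>H. H \<in> C \<Longrightarrow> e \<notin> H"
proof -
  have "\<Union>C \<subset> G"
  proof (cases "C = {}")
    case True then show ?thesis using assms(3) by auto
  next
    case False
    then have "\<Union>C \<in> C"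
      using assms(1) by (intro Union_in_chain[of C UNIV]) (auto simp: chain_subset_alt_def)
    then show ?thesis by (rule assms(2))
  qed
  then show thesis using that by blast
qed

lemma chain_separate_above:
  fixes C :: "'e::finite set set"
  assumes "chain\<^sub>\<subseteq> C" "\<And>H. H \<in> C \<Longrightarrow> G \<subset> H" "G \<noteq> UNIV"
  obtains e where "e \<notin> G" "\<And>H. H \<in> C \<Longrightarrow> e \<in> H"
proof -
  have 1: "chain\<^sub>\<subseteq> (uminus ` C)" using assms(1) unfolding chain_subset_def by auto
  have 2: "H \<subset> - G" if "H \<in> uminus ` C" for H using that assms(2) by blast
  have 3: "- G \<noteq> {}" using assms(3) by blast
  obtain e where "e \<in> - G" "\<And>H. H \<in> uminus ` C \<Longrightarrow> e \<notin> H"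
    by (rule chain_separate_below[OF 1 2 3]) (assumption, rule that)
  then show thesis by (intro that[of e]) auto
qed

text \<open>The dual functionals are explicit. For e_G take the difference of the coordinates at
  some \<open>e\<close> in \<open>G\<close> but in no smaller member, and at some \<open>d\<close>
  outside \<open>G\<close> but in all larger members; every other member contains both or neither.
  For the signed ray take \<open>s\<close> times a coordinate outside all proper members.\<close>

lemma unimodular_flag_gens:
  fixes C :: "'e::finite set set"
  assumes "chain\<^sub>\<subseteq> C" "s \<in> {1, -1}"
  shows "unimodular (flag_gens s C)"
  unfolding unimodular_def
proof (intro conjI ballI)
  show "finite (flag_gens s C)" unfolding flag_gens_def by simp
  show "flag_gens s C \<subseteq> int_lattice"
  proof -
    have "char_vec H \<in> int_lattice" for H :: "'e set" by (simp add: int_lattice_def of_bool_def)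
    moreover have "s *\<^sub>R char_vec UNIV \<in> (int_lattice :: (real^'e) set)"
      using assms(2) by (auto simp: int_lattice_def)
    ultimately show ?thesis unfolding flag_gens_def by blast
  qed
  fix g assume g: "g \<in> flag_gens s C"
  show "\<exists>f::real^'e \<Rightarrow> real. linear f \<and> f g = 1 \<and> (\<forall>h\<in>flag_gens s C - {g}. f h = 0) \<and>
      (\<forall>x\<in>int_lattice. f x \<in> \<int>)"
  proof (cases "g = s *\<^sub>R char_vec UNIV")
    case True
    have "chain\<^sub>\<subseteq> (C - {UNIV})" using assms(1) unfolding chain_subset_def by blast
    then obtain e where e: "\<And>H. H \<in> C - {UNIV} \<Longrightarrow> e \<notin> H"
      using chain_separate_below[of "C - {UNIV}" UNIV] by blast
    show ?thesis
    proof (intro exI[of _ "\<lambda>x. s * x $ e"] conjI ballI)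
      show "linear (\<lambda>x::real^'e. s * x $ e)"
        by (intro linearI) (auto simp: algebra_simps)
      show "s * g $ e = 1" using True assms(2) by auto
      show "s * h $ e = 0" if "h \<in> flag_gens s C - {g}" for h
      proof -
        obtain H where "h = char_vec H" "H \<in> C - {UNIV}"
          using \<open>h \<in> _\<close> True unfolding flag_gens_def by blast
        with e[of H] show ?thesis by simp
      qed
      show "s * x $ e \<in> \<int>" if "x \<in> int_lattice" for x
        using that assms(2) unfolding int_lattice_def by auto
    qed
  next
    case False
    then obtain G where G: "g = char_vec G" "G \<in> C" "G \<noteq> {}" "G \<noteq> UNIV"
      using g unfolding flag_gens_def by auto
    have sub: "chain\<^sub>\<subseteq> {H\<in>C. H \<subset> G}" "chain\<^sub>\<subseteq> {H\<in>C. G \<subset> H}"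
      using assms(1) unfolding chain_subset_def by blast+
    obtain e where e: "e \<in> G" "\<And>H. H \<in> {H\<in>C. H \<subset> G} \<Longrightarrow> e \<notin> H"
      by (rule chain_separate_below[OF sub(1) _ G(3)]) (auto intro: that)
    obtain d where d: "d \<notin> G" "\<And>H. H \<in> {H\<in>C. G \<subset> H} \<Longrightarrow> d \<in> H"
      by (rule chain_separate_above[OF sub(2) _ G(4)]) (auto intro: that)
    have sep: "e \<in> H \<longleftrightarrow> d \<in> H" if "H \<in> C" "H \<noteq> G" for H
    proof -
      have "H \<subset> G \<or> G \<subset> H" using that G(2) assms(1) unfolding chain_subset_def by blast
      then show ?thesis using e d that by blast
    qed
    show ?thesis
    proof (intro exI[of _ "\<lambda>x. x $ e - x $ d"] conjI ballI)
      show "linear (\<lambda>x::real^'e. x $ e - x $ d)"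
        by (intro linearI) (auto simp: algebra_simps)
      show "g $ e - g $ d = 1" using G e d by simp
      show "h $ e - h $ d = 0" if "h \<in> flag_gens s C - {g}" for h
        using that sep G(1) unfolding flag_gens_def by auto
      show "x $ e - x $ d \<in> \<int>" if "x \<in> int_lattice" for x
        using that unfolding int_lattice_def by auto
    qed
  qed
qed

lemma flag_gens_remove:
  assumes "G \<noteq> UNIV" "s \<in> {1, -1}"
  shows "flag_gens s C - {char_vec G} = flag_gens s (C - {G})"
  using assms char_vec_eq_signed_UNIV[OF assms(2), of G] unfolding flag_gens_def by auto

lemma flag_gens_remove_UNIV:
  assumes "s \<in> {1, -1}"
  shows "flag_gens s C - {s *\<^sub>R char_vec UNIV} = char_vec ` (C - {{}, UNIV})"
  using signed_UNIV_notin_image[OF assms, of C] unfolding flag_gens_def by blast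

lemma flag_gens_eqD:
  assumes "flag_gens s C = flag_gens s' C'" "s \<in> {1, -1}" "s' \<in> {1, -1}"
  shows "s = s'" "C - {{}, UNIV} = C' - {{}, UNIV}"
proof -
  have "s' *\<^sub>R char_vec UNIV \<in> flag_gens s C" unfolding assms(1) unfolding flag_gens_def by simp
  then have "s' *\<^sub>R char_vec UNIV = s *\<^sub>R (char_vec UNIV :: real^'a)"
    unfolding flag_gens_def using signed_UNIV_notin_image[OF assms(3), of C] by (meson insertE)
  then show s: "s = s'" by (auto simp: vec_eq_iff)
  have "char_vec ` (C - {{}, UNIV}) = char_vec ` (C' - {{}, UNIV})"
    using flag_gens_remove_UNIV[OF assms(2), of C] flag_gens_remove_UNIV[OF assms(3), of C'] assms(1) s
    by simp
  then show "C - {{}, UNIV} = C' - {{}, UNIV}"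
    by (subst (asm) inj_image_eq_iff) (auto intro: injI)
qed

lemma card_flag_gens:
  assumes "s \<in> {1, -1}"
  shows "card (flag_gens s C) = Suc (card (C - {{}, UNIV}))"
proof -
  have "card (char_vec ` (C - {{}, UNIV})) = card (C - {{}, UNIV})"
    by (intro card_image inj_onI) simp
  then show ?thesis
    using signed_UNIV_notin_image[OF assms, of C] unfolding flag_gens_def
    by (subst card_insert_disjoint) simp_all
qed

section \<open>Saturated chains with arbitrary ends, and their weights\<close>

definition chain_between :: "('a \<Rightarrow> 'a \<Rightarrow> bool) \<Rightarrow> 'a \<Rightarrow> 'a \<Rightarrow> 'a list \<Rightarrow> bool" where
  "chain_between P x y xs \<longleftrightarrow> xs \<noteq> [] \<and> hd xs = x \<and> last xs = y \<and> successively P xs"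

lemma maximal_flag_eq_chain: "maximal_flag R Fs \<longleftrightarrow> chain_between (covers R) {} UNIV Fs"
  unfolding maximal_flag_def chain_between_def by blast

lemma chain_between_append: "chain_between P x z (xs @ y # ys) \<longleftrightarrow> chain_between P x y (xs @ [y]) \<and> chain_between P y z (y # ys)"
  unfolding chain_between_def by (cases xs) (auto simp: successively_append_iff successively_Cons hd_append)

lemma chain_between_Cons: "chain_between P x z (y # y' # ys) \<longleftrightarrow> x = y \<and> P y y' \<and> chain_between P y' z (y' # ys)"
  unfolding chain_between_def by auto

lemma chain_between_singleton [simp]: "chain_between P x z [y] \<longleftrightarrow> x = y \<and> z = y"
  unfolding chain_between_def by auto

text \<open>The standard way to read a flag: the two edges at \<open>w\<close> are separated from
  the chains below \<open>y\<close> and above \<open>y'\<close>, which stay fixed when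
  \<open>w\<close> varies.\<close>

lemma chain_between_insert:
  "chain_between P x z (xs @ y # w # y' # ys) \<longleftrightarrow>
     chain_between P x y (xs @ [y]) \<and> P y w \<and> P w y' \<and> chain_between P y' z (y' # ys)"
  by (subst chain_between_append) (auto simp: chain_between_Cons)

lemma chain_between_insert2:
  "chain_between P x z (xs @ y # y' # ys) \<longleftrightarrow>
     chain_between P x y (xs @ [y]) \<and> P y y' \<and> chain_between P y' z (y' # ys)"
  by (subst chain_between_append) (auto simp: chain_between_Cons)

lemma flag_weight_singleton [simp]: "flag_weight \<omega> [x] = 1"
  by (simp add: flag_weight_def)

lemma flag_weight_Cons [simp]: "flag_weight \<omega> (x # y # zs) = \<omega> x y * flag_weight \<omega> (y # zs)"
  unfolding flag_weight_def by (simp add: prod.lessThan_Suc_shift del: prod.lessThan_Suc)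

lemma flag_weight_append:
  "flag_weight \<omega> (xs @ y # ys) = flag_weight \<omega> (xs @ [y]) * flag_weight \<omega> (y # ys)"
proof (induction xs)
  case (Cons x xs) then show ?case by (cases xs) auto
qed simp

lemma flag_weight_insert:
  "flag_weight \<omega> (xs @ y # w # y' # ys) =
     flag_weight \<omega> (xs @ [y]) * flag_weight \<omega> (y' # ys) * (\<omega> y w * \<omega> w y')"
  by (subst flag_weight_append) simp

text \<open>Cones remember only the set of members of a flag; the list is recovered by repeatedly
  splitting off the least member.\<close>

lemma sorted_wrt_psubset_unique:
  assumes "sorted_wrt (\<subset>) xs" "sorted_wrt (\<subset>) ys" "set xs = set ys"
  shows "xs = ys"
  using assms
proof (induction xs arbitrary: ys)
  case (Cons x xs)
  then obtain y ys' where y: "ys = y # ys'" by (cases ys) auto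
  have "x \<subseteq> z" if "z \<in> set (x # xs)" for z using Cons.prems(1) that by auto
  moreover have "y \<subseteq> z" if "z \<in> set ys" for z using Cons.prems(2) y that by auto
  ultimately have "x = y" using Cons.prems(3) y by (metis list.set_intros(1) subset_antisym)
  moreover have "x \<notin> set xs" "y \<notin> set ys'" using Cons.prems y by auto
  ultimately have "set xs = set ys'" using Cons.prems(3) y by auto
  then show ?case using Cons y \<open>x = y\<close> by auto
qed simp

locale flag_poset =
  fixes \<G> :: "'e::finite set set" and R :: "('e set \<times> 'e set) set"
  assumes ranked: "ranked_set_poset \<G> R"
begin

lemma covers_psubset: "covers R F F' \<Longrightarrow> F \<subset> F'"
  using ranked unfolding ranked_set_poset_def covers_def by blast

lemma covers_carrier:
  assumes "covers R F F'"
  shows "F \<in> \<G>" "F' \<in> \<G>"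
  using assms ranked partial_order_onD(4)[of \<G> R] unfolding ranked_set_poset_def covers_def
  by blast+

text \<open>The rank would have to rise by one and by two at once. This is what makes the place of a
  deleted member visible.\<close>

lemma not_covers_gap:
  assumes "covers R F G" "covers R G F'"
  shows "\<not> covers R F F'"
  using assms ranked unfolding ranked_set_poset_def
  by (metis n_not_Suc_n Suc_inject)

lemma chain_between_sorted:
  assumes "chain_between (covers R) F F' xs"
  shows "sorted_wrt (\<subset>) xs"
proof -
  have "successively (\<subset>) xs"
    using assms covers_psubset successively_mono unfolding chain_between_def by blast
  then show ?thesis
    by (subst (asm) successively_conv_sorted_wrt) (auto simp: transp_def)
qed

lemma chain_between_subset_chain:
  assumes "chain_between (covers R) F F' xs"
  shows "chain\<^sub>\<subseteq> (set xs)"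
  using chain_between_sorted[OF assms] unfolding chain_subset_def
  by (induction xs) auto

lemma chain_between_distinct:
  assumes "chain_between (covers R) F F' xs"
  shows "distinct xs"
  using chain_between_sorted[OF assms] by (induction xs) auto

lemma chain_between_delete:
  assumes "chain_between (covers R) E E' (As @ F # G # F' # Bs)"
  shows "set (As @ F # F' # Bs) = set (As @ F # G # F' # Bs) - {G}" "G \<noteq> {}" "G \<noteq> UNIV"
    "chain\<^sub>\<subseteq> (set (As @ F # F' # Bs))"
proof -
  show *: "set (As @ F # F' # Bs) = set (As @ F # G # F' # Bs) - {G}"
    using chain_between_distinct[OF assms] by auto
  show "G \<noteq> {}" "G \<noteq> UNIV"
    using assms covers_psubset[of F G] covers_psubset[of G F'] by (auto simp: chain_between_insert)
  show "chain\<^sub>\<subseteq> (set (As @ F # F' # Bs))"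
    using chain_between_subset_chain[OF assms] unfolding * chain_subset_def by blast
qed

lemma maximal_flag_contains:
  assumes "maximal_flag R Fs"
  shows "{} \<in> set Fs" "UNIV \<in> set Fs"
  using assms hd_in_set[of Fs] last_in_set[of Fs] unfolding maximal_flag_def by auto

lemma maximal_flag_split:
  assumes "maximal_flag R Fs" "G \<in> set Fs" "G \<noteq> {}" "G \<noteq> UNIV"
  obtains As F F' Bs where "Fs = As @ F # G # F' # Bs"
proof -
  obtain ys zs where yz: "Fs = ys @ G # zs" using assms(2) by (meson split_list)
  have "ys \<noteq> []" "zs \<noteq> []" using assms yz unfolding maximal_flag_def by auto
  then obtain As F F' Bs where "ys = As @ [F]" "zs = F' # Bs"
    by (metis list.exhaust rev_exhaust)
  with yz that show thesis by simp
qed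

text \<open>In a flag with one member deleted, the gap is the only consecutive pair that is not a
  covering. Only its position is determined: \<open>G\<close> and \<open>G'\<close> may differ, and
  this freedom is what the star of a gap cone consists of.\<close>

lemma gap_unique:
  assumes "chain_between (covers R) E E' (As @ F # G # F' # Bs)"
    and "chain_between (covers R) E E' (As' @ H # G' # H' # Bs')"
    and "set (As @ F # F' # Bs) = set (As' @ H # H' # Bs')"
  shows "As' = As" "H = F" "H' = F'" "Bs' = Bs"
proof -
  have "sorted_wrt (\<subset>) (As @ F # F' # Bs)" "sorted_wrt (\<subset>) (As' @ H # H' # Bs')"
    using chain_between_sorted[OF assms(1)] chain_between_sorted[OF assms(2)] by (auto simp: sorted_wrt_append)
  with assms(3) have eq: "(As @ [F]) @ (F' # Bs) = (As' @ [H]) @ (H' # Bs')"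
    by (simp add: sorted_wrt_psubset_unique)
  \<comment> \<open>If the two gaps were at different places, \<open>F\<close> and \<open>F'\<close>
    would be consecutive in the intact upper part of the other flag, hence a covering.
    \<open>us\<close> is the stretch between the two places.\<close>
  have aux: "us = []" if us: "As @ [F] = (As' @ [H]) @ us" "us @ F' # Bs = H' # Bs'"
    and p: "chain_between (covers R) H' E' (H' # Bs')" "covers R F G" "covers R G F'"
    for us As F G F' Bs As' H H' Bs'
  proof (rule ccontr)
    assume "us \<noteq> []"
    then have "last us = F" using us(1) by (metis last_appendR last_snoc)
    moreover have "successively (covers R) (us @ F' # Bs)"
      using p(1) unfolding us(2) chain_between_def by blast
    ultimately have "covers R F F'" using \<open>us \<noteq> []\<close> by (simp add: successively_append_iff)
    then show False using not_covers_gap p by blast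
  qed
  have parts: "chain_between (covers R) F' E' (F' # Bs)" "covers R F G" "covers R G F'"
    "chain_between (covers R) H' E' (H' # Bs')" "covers R H G'" "covers R G' H'"
    using assms(1,2) unfolding chain_between_insert by blast+
  obtain us where "As @ [F] = (As' @ [H]) @ us \<and> us @ F' # Bs = H' # Bs' \<or>
      As' @ [H] = (As @ [F]) @ us \<and> us @ H' # Bs' = F' # Bs"
    using eq by (subst (asm) append_eq_append_conv2) metis
  then have "As @ [F] = As' @ [H] \<and> F' # Bs = H' # Bs'"
  proof
    assume us: "As @ [F] = (As' @ [H]) @ us \<and> us @ F' # Bs = H' # Bs'"
    with aux[of As F As' H us F' Bs H' Bs' G] parts have "us = []" by blast
    with us show ?thesis by simp
  next
    assume us: "As' @ [H] = (As @ [F]) @ us \<and> us @ H' # Bs' = F' # Bs"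
    with aux[of As' H As F us H' Bs' F' Bs G'] parts have "us = []" by blast
    with us show ?thesis by simp
  qed
  then show "As' = As" "H = F" "H' = F'" "Bs' = Bs" by auto
qed

section \<open>Cones of flags and their facets\<close>

lemma unimodular_flag:
  assumes "maximal_flag R Fs" "s \<in> {1, -1}"
  shows "unimodular (flag_gens s (set Fs))"
  using assms chain_between_subset_chain by (auto simp: maximal_flag_eq_chain intro!: unimodular_flag_gens)

text \<open>The members \<open>{}\<close> and \<open>UNIV\<close> are dropped from the generators
  and the signed ray is added, hence the \<open>- 1\<close>.\<close>

lemma dim_flag_cone:
  assumes "maximal_flag R Fs" "s \<in> {1, -1}"
  shows "dim (flag_cone s Fs) = length Fs - 1"
proof -
  have "card (set Fs) = length Fs"
    using assms(1) chain_between_distinct distinct_card unfolding maximal_flag_eq_chain by blast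
  moreover have "card (set Fs - {{}, UNIV}) = card (set Fs) - 2"
    using maximal_flag_contains[OF assms(1)] by (subst card_Diff_subset) auto
  moreover have "card (set Fs) \<ge> card {{}, UNIV :: 'e set}"
    using maximal_flag_contains[OF assms(1)] by (intro card_mono) auto
  ultimately show ?thesis
    using dim_unimodular_cone[OF unimodular_flag[OF assms]] card_flag_gens[OF assms(2), of "set Fs"]
    by (simp add: flag_cone_eq_hull)
qed

lemma gap_cone_eq:
  assumes "maximal_flag R (As @ F # G # F' # Bs)" "s \<in> {1, -1}"
  shows "flag_cone s (As @ F # F' # Bs) =
    convex_cone hull (flag_gens s (set (As @ F # G # F' # Bs)) - {char_vec G})"
  unfolding flag_cone_eq_hull chain_between_delete(1)[OF assms(1)[unfolded maximal_flag_eq_chain]]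
  using flag_gens_remove chain_between_delete(3) assms unfolding maximal_flag_eq_chain by metis

lemma gap_gen:
  assumes "maximal_flag R (As @ F # G # F' # Bs)"
  shows "char_vec G \<in> flag_gens s (set (As @ F # G # F' # Bs))"
  using chain_between_delete(2,3)[OF assms(1)[unfolded maximal_flag_eq_chain]] unfolding flag_gens_def by simp

lemma gap_facet:
  assumes "maximal_flag R (As @ F # G # F' # Bs)" "s \<in> {1, -1}"
  shows "flag_cone s (As @ F # F' # Bs) facet_of flag_cone s (As @ F # G # F' # Bs)"
  using unimodular_facet_iff[OF unimodular_flag[OF assms]] gap_gen[OF assms(1), of s]
  unfolding gap_cone_eq[OF assms] flag_cone_eq_hull[of s "As @ F # G # F' # Bs"] by blast

lemma primitive_vec_gap:
  assumes "maximal_flag R (As @ F # G # F' # Bs)" "s \<in> {1, -1}"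
  shows "primitive_vec (flag_cone s (As @ F # G # F' # Bs)) (flag_cone s (As @ F # F' # Bs)) -
    char_vec G \<in> span (flag_cone s (As @ F # F' # Bs))"
  using primitive_vec_unimodular[OF unimodular_flag[OF assms] gap_gen[OF assms(1)]]
  unfolding gap_cone_eq[OF assms] flag_cone_eq_hull[of s "As @ F # G # F' # Bs"] span_convex_cone_hull .

text \<open>The facet common to the two signed copies of a flag cone, hence without a sign.\<close>

definition base_cone :: "'e set list \<Rightarrow> (real ^ 'e) set" where
  "base_cone Fs = convex_cone hull (char_vec ` (set Fs - {{}, UNIV}))"

lemma base_cone_eq:
  assumes "s \<in> {1, -1}"
  shows "base_cone Fs = convex_cone hull (flag_gens s (set Fs) - {s *\<^sub>R char_vec UNIV})"
  unfolding base_cone_def flag_gens_remove_UNIV[OF assms] ..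

lemma sign_gen: "s *\<^sub>R char_vec UNIV \<in> flag_gens s C"
  unfolding flag_gens_def by simp

lemma base_facet:
  assumes "maximal_flag R Fs" "s \<in> {1, -1}"
  shows "base_cone Fs facet_of flag_cone s Fs"
  using unimodular_facet_iff[OF unimodular_flag[OF assms]] sign_gen
  unfolding base_cone_eq[OF assms(2)] flag_cone_eq_hull by blast

lemma primitive_vec_base:
  assumes "maximal_flag R Fs" "s \<in> {1, -1}"
  shows "primitive_vec (flag_cone s Fs) (base_cone Fs) - s *\<^sub>R char_vec UNIV \<in> span (base_cone Fs)"
  using primitive_vec_unimodular[OF unimodular_flag[OF assms] sign_gen]
  unfolding base_cone_eq[OF assms(2)] flag_cone_eq_hull span_convex_cone_hull .

text \<open>A facet lacks one generator, either the signed ray or e_G for a proper nonempty member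
  \<open>G\<close>; such a member has neighbours on both sides in the flag.\<close>

lemma flag_facet_cases:
  assumes "maximal_flag R Fs" "s \<in> {1, -1}" "\<tau> facet_of flag_cone s Fs"
  obtains (base) "\<tau> = base_cone Fs"
  | (gap) As F G F' Bs where "Fs = As @ F # G # F' # Bs" "\<tau> = flag_cone s (As @ F # F' # Bs)"
proof -
  obtain g where g: "g \<in> flag_gens s (set Fs)" "\<tau> = convex_cone hull (flag_gens s (set Fs) - {g})"
    using assms(3) unimodular_facet_iff[OF unimodular_flag[OF assms(1,2)]]
    unfolding flag_cone_eq_hull by blast
  show thesis
  proof (cases "g = s *\<^sub>R char_vec UNIV")
    case True
    then show thesis using base g(2) base_cone_eq[OF assms(2)] by simp
  next
    case False
    then obtain G where G: "g = char_vec G" "G \<in> set Fs" "G \<noteq> {}" "G \<noteq> UNIV"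
      using g(1) unfolding flag_gens_def by auto
    obtain As F F' Bs where Fs: "Fs = As @ F # G # F' # Bs"
      using maximal_flag_split[OF assms(1) G(2-4)] .
    show thesis using gap[OF Fs] g(2) gap_cone_eq[of As F G F' Bs s] assms(1,2) Fs G(1) by simp
  qed
qed

lemma gap_cone_neq_base:
  assumes "maximal_flag R (As @ F # G # F' # Bs)" "s \<in> {1, -1}" "maximal_flag R Fs"
  shows "flag_cone s (As @ F # F' # Bs) \<noteq> base_cone Fs"
proof
  assume eq: "flag_cone s (As @ F # F' # Bs) = base_cone Fs"
  have "flag_gens s (set (As @ F # F' # Bs)) = char_vec ` (set Fs - {{}, UNIV})"
  proof (rule unimodular_hull_inject)
    show "unimodular (flag_gens s (set (As @ F # F' # Bs)))"
      using chain_between_delete(4) assms(1,2) unfolding maximal_flag_eq_chain by (intro unimodular_flag_gens)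
    show "unimodular (char_vec ` (set Fs - {{}, UNIV}))"
      using unimodular_subset[OF unimodular_flag[OF assms(3,2)]] unfolding flag_gens_def by blast
  qed (use eq in \<open>simp add: flag_cone_eq_hull base_cone_def\<close>)
  then show False using signed_UNIV_notin_image[OF assms(2), of "set Fs"] sign_gen by metis
qed

text \<open>The cone determines its generators, these determine the sign and the set of members, and
  the latter determines the position of the gap.\<close>

lemma gap_cone_inject:
  assumes "maximal_flag R (As @ F # G # F' # Bs)" "s \<in> {1, -1}"
    and "maximal_flag R (As' @ H # G' # H' # Bs')" "s' \<in> {1, -1}"
    and eq: "flag_cone s (As @ F # F' # Bs) = flag_cone s' (As' @ H # H' # Bs')"
  shows "s' = s" "As' = As" "H = F" "H' = F'" "Bs' = Bs"
proof -
  have "flag_gens s (set (As @ F # F' # Bs)) = flag_gens s' (set (As' @ H # H' # Bs'))"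
  proof (rule unimodular_hull_inject)
    show "unimodular (flag_gens s (set (As @ F # F' # Bs)))"
      using chain_between_delete(4) assms(1,2) unfolding maximal_flag_eq_chain
      by (intro unimodular_flag_gens)
    show "unimodular (flag_gens s' (set (As' @ H # H' # Bs')))"
      using chain_between_delete(4) assms(3,4) unfolding maximal_flag_eq_chain
      by (intro unimodular_flag_gens)
  qed (use eq in \<open>simp only: flag_cone_eq_hull\<close>)
  note D = flag_gens_eqD[OF this assms(2,4)]
  from D(1) show "s' = s" by simp
  have "{} \<in> set (As @ F # F' # Bs)" "UNIV \<in> set (As @ F # F' # Bs)"
    "{} \<in> set (As' @ H # H' # Bs')" "UNIV \<in> set (As' @ H # H' # Bs')"
    using maximal_flag_contains[OF assms(1)] maximal_flag_contains[OF assms(3)]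
      chain_between_delete(1-3)[OF assms(1)[unfolded maximal_flag_eq_chain]]
      chain_between_delete(1-3)[OF assms(3)[unfolded maximal_flag_eq_chain]] by blast+
  with D(2) have "set (As @ F # F' # Bs) = set (As' @ H # H' # Bs')" by blast
  with assms(1,3) show "As' = As" "H = F" "H' = F'" "Bs' = Bs"
    using gap_unique unfolding maximal_flag_eq_chain by metis+
qed

lemma flag_cone_inject:
  assumes "maximal_flag R Fs" "s \<in> {1, -1}" "maximal_flag R Fs'" "s' \<in> {1, -1}"
    and eq: "flag_cone s Fs = flag_cone s' Fs'"
  shows "s' = s" "Fs' = Fs"
proof -
  have "flag_gens s (set Fs) = flag_gens s' (set Fs')"
    using unimodular_hull_inject[OF unimodular_flag[OF assms(1,2)] unimodular_flag[OF assms(3,4)]] eq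
    unfolding flag_cone_eq_hull by blast
  note D = flag_gens_eqD[OF this assms(2,4)]
  from D(1) show "s' = s" by simp
  from D(2) have "set Fs' = set Fs"
    using maximal_flag_contains[OF assms(1)] maximal_flag_contains[OF assms(3)] by blast
  then show "Fs' = Fs"
    using assms(1,3) chain_between_sorted sorted_wrt_psubset_unique unfolding maximal_flag_eq_chain by metis
qed

lemma base_cone_inject:
  assumes "maximal_flag R Fs" "maximal_flag R Fs'" "base_cone Fs = base_cone Fs'"
  shows "Fs' = Fs"
proof -
  have "unimodular (char_vec ` (set Fs - {{}, UNIV}))" if "maximal_flag R Fs" for Fs
    using unimodular_subset[OF unimodular_flag[OF that, of 1]] unfolding flag_gens_def by blast
  then have "char_vec ` (set Fs - {{}, UNIV}) = char_vec ` (set Fs' - {{}, UNIV})"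
    using assms unimodular_hull_inject unfolding base_cone_def by metis
  then have "flag_gens 1 (set Fs) = flag_gens 1 (set Fs')" unfolding flag_gens_def by simp
  then show ?thesis
    using flag_cone_inject(2)[OF assms(1) _ assms(2), of 1 1] by (simp add: flag_cone_eq_hull)
qed

end

text \<open>Balancing is not assumed here, so that the description of stars and the criterion
  \<open>balanced_iff\<close> also apply to the divisor before it is known to be balanced.\<close>

locale flag_fan = flag_poset +
  fixes X :: "(real ^ 'e::finite) weighted_fan" and \<omega> :: "'e set \<Rightarrow> 'e set \<Rightarrow> int"
  assumes cones: "cones X = {flag_cone s Fs | s Fs. s \<in> {1, -1} \<and> maximal_flag R Fs}"
    and weight: "\<And>s Fs. s \<in> {1, -1} \<Longrightarrow> maximal_flag R Fs \<Longrightarrow>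
      weight X (flag_cone s Fs) = of_int (flag_weight \<omega> Fs)"
begin

text \<open>The cones around a flag with a gap are the ways to refill it: by
  \<open>gap_cone_inject\<close> each of them has its gap at the same place and carries the same
  sign.\<close>

lemma star_gap:
  assumes "maximal_flag R (As @ F # G0 # F' # Bs)" "s \<in> {1, -1}"
  shows "star X (flag_cone s (As @ F # F' # Bs)) =
    (\<lambda>G. flag_cone s (As @ F # G # F' # Bs)) ` {G. covers R F G \<and> covers R G F'}"
    and "inj_on (\<lambda>G. flag_cone s (As @ F # G # F' # Bs)) {G. covers R F G \<and> covers R G F'}"
    and "covers R F G \<Longrightarrow> covers R G F' \<Longrightarrow> maximal_flag R (As @ F # G # F' # Bs)"
proof -
  have max: "maximal_flag R (As @ F # G # F' # Bs)" if "covers R F G" "covers R G F'" for G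
    using assms(1) that unfolding maximal_flag_eq_chain chain_between_insert by blast
  then show "covers R F G \<Longrightarrow> covers R G F' \<Longrightarrow> maximal_flag R (As @ F # G # F' # Bs)" .
  show "inj_on (\<lambda>G. flag_cone s (As @ F # G # F' # Bs)) {G. covers R F G \<and> covers R G F'}"
  proof (rule inj_onI)
    fix G H assume "G \<in> {G. covers R F G \<and> covers R G F'}" "H \<in> {G. covers R F G \<and> covers R G F'}"
      "flag_cone s (As @ F # G # F' # Bs) = flag_cone s (As @ F # H # F' # Bs)"
    then show "G = H"
      using flag_cone_inject(2)[OF max assms(2) max assms(2), of G H] by simp
  qed
  show "star X (flag_cone s (As @ F # F' # Bs)) =
    (\<lambda>G. flag_cone s (As @ F # G # F' # Bs)) ` {G. covers R F G \<and> covers R G F'}" (is "_ = ?R")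
  proof
    show "?R \<subseteq> star X (flag_cone s (As @ F # F' # Bs))"
      using gap_facet max assms(2) unfolding star_def cones by blast
    show "star X (flag_cone s (As @ F # F' # Bs)) \<subseteq> ?R"
    proof
      fix \<sigma> assume "\<sigma> \<in> star X (flag_cone s (As @ F # F' # Bs))"
      then obtain s' Fs where \<sigma>: "\<sigma> = flag_cone s' Fs" "s' \<in> {1, -1}" "maximal_flag R Fs"
        and facet: "flag_cone s (As @ F # F' # Bs) facet_of flag_cone s' Fs"
        unfolding star_def cones by blast
      show "\<sigma> \<in> ?R" using \<sigma>(3,2) facet
      proof (cases rule: flag_facet_cases)
        case base
        then show ?thesis using gap_cone_neq_base[OF assms \<sigma>(3)] by blast
      next
        case (gap As' H G' H' Bs')
        note eqs = gap_cone_inject[OF assms(1,2) \<sigma>(3)[unfolded gap(1)] \<sigma>(2) gap(2)]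
        then have "covers R F G'" "covers R G' F'"
          using \<sigma>(3) gap(1) unfolding maximal_flag_eq_chain by (auto simp: chain_between_insert)
        then show ?thesis using gap(1) eqs \<sigma>(1) by blast
      qed
    qed
  qed
qed

lemma star_base:
  assumes "maximal_flag R Fs"
  shows "star X (base_cone Fs) = {flag_cone 1 Fs, flag_cone (-1) Fs}"
    and "flag_cone 1 Fs \<noteq> flag_cone (-1) Fs"
proof -
  show "flag_cone 1 Fs \<noteq> flag_cone (-1) Fs"
    using flag_cone_inject(1)[OF assms _ assms, of 1 "-1"] by auto
  show "star X (base_cone Fs) = {flag_cone 1 Fs, flag_cone (-1) Fs}"
  proof
    have "flag_cone s Fs \<in> star X (base_cone Fs)" if "s \<in> {1, -1}" for s
      using base_facet[OF assms that] that assms unfolding star_def cones by blast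
    then show "{flag_cone 1 Fs, flag_cone (-1) Fs} \<subseteq> star X (base_cone Fs)" by simp
    show "star X (base_cone Fs) \<subseteq> {flag_cone 1 Fs, flag_cone (-1) Fs}"
    proof
      fix \<sigma> assume "\<sigma> \<in> star X (base_cone Fs)"
      then obtain s Fs' where \<sigma>: "\<sigma> = flag_cone s Fs'" "s \<in> {1, -1}" "maximal_flag R Fs'"
        and facet: "base_cone Fs facet_of flag_cone s Fs'"
        unfolding star_def cones by blast
      show "\<sigma> \<in> {flag_cone 1 Fs, flag_cone (-1) Fs}" using \<sigma>(3,2) facet
      proof (cases rule: flag_facet_cases)
        case base
        then show ?thesis using base_cone_inject[OF assms \<sigma>(3)] \<sigma>(1,2) by auto
      next
        case (gap As' H G' H' Bs')
        then show ?thesis using gap_cone_neq_base \<sigma> assms by metis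
      qed
    qed
  qed
qed

end

section \<open>Balancing and Weil divisors in terms of flags\<close>

lemma linear_ext_eq:
  assumes "linear g" "\<And>x. x \<in> \<sigma> \<Longrightarrow> \<phi> x = g x"
  shows "linear (linear_ext \<phi> \<sigma>)" "x \<in> \<sigma> \<Longrightarrow> linear_ext \<phi> \<sigma> x = \<phi> x"
proof -
  have "linear (linear_ext \<phi> \<sigma>) \<and> (\<forall>x\<in>\<sigma>. linear_ext \<phi> \<sigma> x = \<phi> x)"
    unfolding linear_ext_def by (rule someI[of _ g]) (use assms in auto)
  then show "linear (linear_ext \<phi> \<sigma>)" "x \<in> \<sigma> \<Longrightarrow> linear_ext \<phi> \<sigma> x = \<phi> x" by auto
qed

lemma char_vec_in_flag_cone:
  assumes "G \<in> set Fs" "G \<noteq> UNIV"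
  shows "char_vec G \<in> flag_cone s Fs"
  unfolding flag_cone_def using assms by (intro hull_inc) auto

lemma signed_UNIV_in_flag_cone: "s *\<^sub>R char_vec UNIV \<in> flag_cone s Fs"
  unfolding flag_cone_def by (intro hull_inc) auto

lemma char_vec_in_span_flag_cone:
  assumes "G \<in> set Fs" "s \<in> {1, -1}"
  shows "char_vec G \<in> span (flag_cone s Fs)"
proof (cases "G = UNIV")
  case True
  have "s *\<^sub>R (s *\<^sub>R char_vec UNIV) \<in> span (flag_cone s Fs)"
    by (intro span_scale span_base signed_UNIV_in_flag_cone)
  then show ?thesis using assms(2) True by auto
qed (use assms in \<open>auto intro!: span_base char_vec_in_flag_cone\<close>)

context flag_poset
begin

lemma maximal_flag_carrier:
  assumes "maximal_flag R Fs" "G \<in> set Fs"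
  shows "G \<in> \<G>"
proof (cases "G = {} \<or> G = UNIV")
  case True
  then show ?thesis using ranked unfolding ranked_set_poset_def by blast
next
  case False
  then obtain As F F' Bs where "Fs = As @ F # G # F' # Bs"
    using maximal_flag_split[OF assms] by metis
  then show ?thesis
    using assms(1) covers_carrier(2)[of F G] unfolding maximal_flag_eq_chain
    by (simp add: chain_between_insert)
qed

abbreviation between :: "'e set \<Rightarrow> 'e set \<Rightarrow> 'e set set" where
  "between F F' \<equiv> {G. covers R F G \<and> covers R G F'}"

text \<open>Every member of the flag lies below \<open>F\<close> or above \<open>F'\<close>, so no
  generator separates two elements of \<open>F' - F\<close>.\<close>

lemma span_gap_const:
  assumes "maximal_flag R (As @ F # G # F' # Bs)" "v \<in> span (flag_cone s (As @ F # F' # Bs))"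
    and "e \<in> F' - F" "d \<in> F' - F"
  shows "v $ e = v $ d"
proof -
  have "sorted_wrt (\<subset>) (As @ F # G # F' # Bs)"
    using chain_between_sorted assms(1) unfolding maximal_flag_eq_chain by blast
  then have "H \<subseteq> F \<or> F' \<subseteq> H" if "H \<in> set (As @ F # F' # Bs)" for H
    using that by (auto simp: sorted_wrt_append)
  then have "char_vec H $ e = (char_vec H $ d :: real)" if "H \<in> set (As @ F # F' # Bs)" for H
  proof -
    have "H \<subseteq> F \<or> F' \<subseteq> H"
      using that \<open>\<And>H. H \<in> set (As @ F # F' # Bs) \<Longrightarrow> H \<subseteq> F \<or> F' \<subseteq> H\<close> by blast
    then have "e \<in> H \<longleftrightarrow> d \<in> H" using assms(3,4) by blast
    then show ?thesis by simp
  qed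
  then have "flag_gens s (set (As @ F # F' # Bs)) \<subseteq> {v. v $ e = v $ d}"
    unfolding flag_gens_def by (auto simp del: set_append char_vec_nth) simp
  moreover have "subspace {v :: real^'e. v $ e = v $ d}"
    by (auto simp: subspace_def)
  ultimately show ?thesis
    using assms(2) span_minimal unfolding flag_cone_eq_hull span_convex_cone_hull by blast
qed

text \<open>Each \<open>G\<close> lies between \<open>F\<close> and \<open>F'\<close>, so the
  coordinates on \<open>F\<close> and outside \<open>F'\<close> are known; the assumption supplies
  those in \<open>F' - F\<close>.\<close>

lemma gap_sum_eq:
  fixes c :: "'e set \<Rightarrow> real"
  assumes "F \<subseteq> F'"
    and "\<And>e. e \<in> F' - F \<Longrightarrow> (\<Sum>G\<in>between F F'. c G *\<^sub>R char_vec G) $ e = D"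
  shows "(\<Sum>G\<in>between F F'. c G *\<^sub>R char_vec G) =
    ((\<Sum>G\<in>between F F'. c G) - D) *\<^sub>R char_vec F + D *\<^sub>R char_vec F'" (is "?v = _")
proof -
  have nth: "?v $ i = (\<Sum>G\<in>between F F'. c G * of_bool (i \<in> G))" for i
    by simp
  have "?v $ i = (((\<Sum>G\<in>between F F'. c G) - D) *\<^sub>R char_vec F + D *\<^sub>R char_vec F') $ i" for i
  proof -
    consider "i \<in> F" | "i \<in> F' - F" | "i \<notin> F'" by blast
    then show ?thesis
    proof cases
      case 1
      then have "?v $ i = (\<Sum>G\<in>between F F'. c G)"
        unfolding nth using covers_psubset by (intro sum.cong) auto
      then show ?thesis using 1 assms(1) by auto
    next
      case 2
      then show ?thesis using assms(2)[OF 2] by auto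
    next
      case 3
      then have "?v $ i = 0"
        unfolding nth using covers_psubset by (intro sum.neutral) auto
      then show ?thesis using 3 assms(1) by auto
    qed
  qed
  then show ?thesis by (subst vec_eq_iff) blast
qed

text \<open>The balancing condition around a gap in coordinates: the weighted sum of the e_G is
  constant on \<open>F' - F\<close>. The weights of the other edges of the flag are factored
  out.\<close>

definition balanced_at :: "('e set \<Rightarrow> 'e set \<Rightarrow> int) \<Rightarrow> 'e set \<Rightarrow> 'e set \<Rightarrow> bool" where
  "balanced_at \<omega> F F' \<longleftrightarrow> (\<forall>e\<in>F' - F. \<forall>d\<in>F' - F.
     (\<Sum>G\<in>between F F'. of_bool (e \<in> G) * (\<omega> F G * \<omega> G F')) =
     (\<Sum>G\<in>between F F'. of_bool (d \<in> G) * (\<omega> F G * \<omega> G F')))"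

lemma gap_sum_in_span_iff:
  fixes P :: int and \<omega> :: "'e set \<Rightarrow> 'e set \<Rightarrow> int"
  assumes "maximal_flag R (As @ F # G0 # F' # Bs)" "s \<in> {1, -1}"
  defines "v \<equiv> \<Sum>G\<in>between F F'. real_of_int (P * (\<omega> F G * \<omega> G F')) *\<^sub>R char_vec G"
  shows "v \<in> span (flag_cone s (As @ F # F' # Bs)) \<longleftrightarrow> P = 0 \<or> balanced_at \<omega> F F'"
proof -
  have sub: "F \<subset> F'"
    using assms(1) covers_psubset[of F G0] covers_psubset[of G0 F']
    unfolding maximal_flag_eq_chain chain_between_insert by blast
  have nth: "v $ e = real_of_int (P * (\<Sum>G\<in>between F F'. of_bool (e \<in> G) * (\<omega> F G * \<omega> G F')))" for e
    unfolding v_def by (simp add: sum_distrib_left mult_ac)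
  have "v \<in> span (flag_cone s (As @ F # F' # Bs)) \<longleftrightarrow> (\<forall>e\<in>F' - F. \<forall>d\<in>F' - F. v $ e = v $ d)"
  proof
    assume "v \<in> span (flag_cone s (As @ F # F' # Bs))"
    then show "\<forall>e\<in>F' - F. \<forall>d\<in>F' - F. v $ e = v $ d"
      using span_gap_const[OF assms(1)] by blast
  next
    assume const: "\<forall>e\<in>F' - F. \<forall>d\<in>F' - F. v $ e = v $ d"
    obtain e where "e \<in> F' - F" using sub by blast
    with const have "v = ((\<Sum>G\<in>between F F'. real_of_int (P * (\<omega> F G * \<omega> G F'))) - v $ e) *\<^sub>R char_vec F
        + (v $ e) *\<^sub>R char_vec F'"
      unfolding v_def using sub by (intro gap_sum_eq) blast+
    also have "\<dots> \<in> span (flag_cone s (As @ F # F' # Bs))"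
    proof (rule span_add; rule span_scale)
      show "char_vec F \<in> span (flag_cone s (As @ F # F' # Bs))"
        by (rule char_vec_in_span_flag_cone[OF _ assms(2)]) simp
      show "char_vec F' \<in> span (flag_cone s (As @ F # F' # Bs))"
        by (rule char_vec_in_span_flag_cone[OF _ assms(2)]) simp
    qed
    finally show "v \<in> span (flag_cone s (As @ F # F' # Bs))" .
  qed
  then show ?thesis
    unfolding nth balanced_at_def of_int_eq_iff mult_cancel_left by blast
qed

text \<open>Expresses that the factor \<open>P\<close> of \<open>gap_sum_in_span_iff\<close> can be
  made nonzero on one side of the gap; only then does balancing of the fan imply
  \<open>balanced_at\<close>.\<close>

definition supported :: "('e set \<Rightarrow> 'e set \<Rightarrow> int) \<Rightarrow> 'e set \<Rightarrow> 'e set \<Rightarrow> bool" where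
  "supported \<omega> F F' \<longleftrightarrow> (\<exists>xs. chain_between (covers R) F F' xs \<and> flag_weight \<omega> xs \<noteq> 0)"

end

context flag_fan
begin

definition star_sum :: "(real ^ 'e) set \<Rightarrow> real ^ 'e" where
  "star_sum \<tau> = (\<Sum>\<sigma>\<in>star X \<tau>. weight X \<sigma> *\<^sub>R primitive_vec \<sigma> \<tau>)"

lemma star_sum_base:
  assumes "maximal_flag R Fs"
  shows "star_sum (base_cone Fs) \<in> span (base_cone Fs)"
proof -
  let ?p = "\<lambda>s. primitive_vec (flag_cone s Fs) (base_cone Fs)"
  have "star_sum (base_cone Fs) = of_int (flag_weight \<omega> Fs) *\<^sub>R
      ((?p 1 - 1 *\<^sub>R char_vec UNIV) + (?p (-1) - (-1) *\<^sub>R char_vec UNIV))"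
    unfolding star_sum_def star_base(1)[OF assms] using star_base(2)[OF assms] assms
    by (simp add: weight scaleR_add_right scaleR_diff_right)
  also have "\<dots> \<in> span (base_cone Fs)"
    by (intro span_scale span_add primitive_vec_base[OF assms]) simp_all
  finally show ?thesis .
qed

text \<open>Stated for general \<open>h\<close>, since it is applied both to the vector sum in the
  balancing condition and to the sum of values of \<phi> in the divisor.\<close>

lemma sum_star_gap:
  assumes "maximal_flag R (As @ F # G0 # F' # Bs)" "s \<in> {1, -1}"
  shows "(\<Sum>\<sigma>\<in>star X (flag_cone s (As @ F # F' # Bs)). h (weight X \<sigma>) \<sigma>) =
    (\<Sum>G\<in>between F F'. h (of_int (flag_weight \<omega> (As @ [F]) * flag_weight \<omega> (F' # Bs) * (\<omega> F G * \<omega> G F')))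
      (flag_cone s (As @ F # G # F' # Bs)))"
  unfolding star_gap(1)[OF assms] sum.reindex[OF star_gap(2)[OF assms]] comp_def
  using weight[OF assms(2) star_gap(3)[OF assms]]
  by (intro sum.cong) (auto simp: flag_weight_insert)

text \<open>Modulo the span of the facet each primitive vector may be replaced by e_G.\<close>

lemma star_sum_gap:
  assumes "maximal_flag R (As @ F # G0 # F' # Bs)" "s \<in> {1, -1}"
  shows "star_sum (flag_cone s (As @ F # F' # Bs)) \<in> span (flag_cone s (As @ F # F' # Bs)) \<longleftrightarrow>
    flag_weight \<omega> (As @ [F]) * flag_weight \<omega> (F' # Bs) = 0 \<or> balanced_at \<omega> F F'"
proof -
  let ?\<tau> = "flag_cone s (As @ F # F' # Bs)"
  let ?P = "flag_weight \<omega> (As @ [F]) * flag_weight \<omega> (F' # Bs)"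
  let ?c = "\<lambda>G. real_of_int (?P * (\<omega> F G * \<omega> G F'))"
  let ?p = "\<lambda>G. primitive_vec (flag_cone s (As @ F # G # F' # Bs)) ?\<tau>"
  have "star_sum ?\<tau> = (\<Sum>G\<in>between F F'. ?c G *\<^sub>R ?p G)"
    unfolding star_sum_def by (rule sum_star_gap[OF assms])
  also have "\<dots> = (\<Sum>G\<in>between F F'. ?c G *\<^sub>R char_vec G) +
      (\<Sum>G\<in>between F F'. ?c G *\<^sub>R (?p G - char_vec G))"
    by (simp add: sum.distrib[symmetric] scaleR_diff_right)
  finally have eq: "star_sum ?\<tau> = \<dots>" .
  have "(\<Sum>G\<in>between F F'. ?c G *\<^sub>R (?p G - char_vec G)) \<in> span ?\<tau>"
    using primitive_vec_gap[OF star_gap(3)[OF assms] assms(2)]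
    by (intro span_sum span_scale) blast
  then show ?thesis
    unfolding eq gap_sum_in_span_iff[OF assms, symmetric] by (rule span_add_eq2)
qed

text \<open>Around a base cone the two signed rays cancel, so only gaps impose conditions. Such a
  condition depends on the rest of the flag only through the vanishing or not of its weight.\<close>

lemma balanced_iff:
  "(\<forall>\<tau>. star X \<tau> \<noteq> {} \<longrightarrow> star_sum \<tau> \<in> span \<tau>) \<longleftrightarrow>
   (\<forall>F F'. supported \<omega> {} F \<longrightarrow> supported \<omega> F' UNIV \<longrightarrow> balanced_at \<omega> F F')"
proof (intro iffI allI impI)
  fix F F' assume bal: "\<forall>\<tau>. star X \<tau> \<noteq> {} \<longrightarrow> star_sum \<tau> \<in> span \<tau>"
    and "supported \<omega> {} F" "supported \<omega> F' UNIV"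
  then obtain xs ys where xs: "chain_between (covers R) {} F xs" "flag_weight \<omega> xs \<noteq> 0"
    and ys: "chain_between (covers R) F' UNIV ys" "flag_weight \<omega> ys \<noteq> 0"
    unfolding supported_def by blast
  obtain As Bs where eqs: "xs = As @ [F]" "ys = F' # Bs"
    using xs(1) ys(1) unfolding chain_between_def
    by (metis append_butlast_last_id list.collapse)
  show "balanced_at \<omega> F F'"
  proof (cases "between F F' = {}")
    case True
    show ?thesis unfolding balanced_at_def True by simp
  next
    case False
    then obtain G0 where "G0 \<in> between F F'" by blast
    then have max: "maximal_flag R (As @ F # G0 # F' # Bs)"
      using xs(1) ys(1) eqs unfolding maximal_flag_eq_chain chain_between_insert by blast
    have "star X (flag_cone 1 (As @ F # F' # Bs)) \<noteq> {}"
      unfolding star_gap(1)[OF max, of 1, simplified] using False by simp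
    with bal have "star_sum (flag_cone 1 (As @ F # F' # Bs)) \<in> span (flag_cone 1 (As @ F # F' # Bs))"
      by blast
    then show ?thesis using star_sum_gap[OF max, of 1] xs(2) ys(2) eqs by simp
  qed
next
  fix \<tau>
  assume bal: "\<forall>F F'. supported \<omega> {} F \<longrightarrow> supported \<omega> F' UNIV \<longrightarrow> balanced_at \<omega> F F'"
    and "star X \<tau> \<noteq> {}"
  then obtain s Fs where s: "s \<in> {1, -1}" "maximal_flag R Fs" "\<tau> facet_of flag_cone s Fs"
    unfolding star_def cones by blast
  show "star_sum \<tau> \<in> span \<tau>" using s(2,1,3)
  proof (cases rule: flag_facet_cases)
    case base
    then show ?thesis using star_sum_base[OF s(2)] by simp
  next
    case (gap As F G F' Bs)
    have "chain_between (covers R) {} F (As @ [F])" "chain_between (covers R) F' UNIV (F' # Bs)"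
      using s(2) unfolding gap(1) maximal_flag_eq_chain chain_between_insert by blast+
    then have "flag_weight \<omega> (As @ [F]) * flag_weight \<omega> (F' # Bs) = 0 \<or> balanced_at \<omega> F F'"
      using bal unfolding supported_def by fastforce
    then show ?thesis
      using star_sum_gap[of As F G F' Bs s] s(1,2) gap by blast
  qed
qed

end

section \<open>The Weil divisor of a cut function\<close>

locale cut_fan = flag_fan \<G> R X \<omega>
  for \<G> :: "'e::finite set set" and R X \<omega> +
  fixes \<A> :: "'e set set" and \<phi> :: "real ^ 'e \<Rightarrow> real"
  assumes balanced: "\<And>\<tau>. star X \<tau> \<noteq> {} \<Longrightarrow> star_sum \<tau> \<in> span \<tau>"
    and cut: "is_cut \<G> \<A>"
    and cut_function: "cut_function X \<G> \<A> \<phi>"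
begin

text \<open>
  \<open>{}\<close> is dropped since \<open>e\<^sub>F = 0\<close> for \<open>F = {}\<close>; every flag then starts outside \<open>B\<close>, also for the cut \<open>\<A> = \<G>\<close>.
\<close>

definition B :: "'e set set" where
  "B = \<A> - {{}}"

definition selected :: "'e set \<Rightarrow> 'e set \<Rightarrow> 'e" where
  "selected F F' = (SOME e. e \<in> F' - F)"

text \<open>
  By balancing, the first part of the sum does not depend on the element of \<open>F' - F\<close> that is
  selected, provided some flag through \<open>F\<close> and \<open>F'\<close> has nonzero weights on its other edges.
\<close>

definition jump_weight :: "'e set \<Rightarrow> 'e set \<Rightarrow> int" where
  "jump_weight F F' = (\<Sum>G\<in>between F F'.
     (of_bool (selected F F' \<in> G) - of_bool (G \<in> B)) * (\<omega> F G * \<omega> G F'))"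

lemma B_upward: "F \<in> B \<Longrightarrow> F \<subseteq> F' \<Longrightarrow> F' \<in> \<G> \<Longrightarrow> F' \<in> B"
  using cut unfolding is_cut_def B_def by blast

lemma covers_B: "covers R F F' \<Longrightarrow> F \<in> B \<Longrightarrow> F' \<in> B"
  using B_upward[of F F'] covers_psubset[of F F'] covers_carrier(2)[of F F'] by blast

lemma linear_ext_facet:
  assumes "\<sigma> \<in> cones X" "\<tau> \<subseteq> \<sigma>"
  shows "linear (linear_ext \<phi> \<tau>)" "x \<in> \<tau> \<Longrightarrow> linear_ext \<phi> \<tau> x = \<phi> x"
    "x \<in> span \<tau> \<Longrightarrow> linear_ext \<phi> \<sigma> x = linear_ext \<phi> \<tau> x"
proof -
  obtain g where g: "linear g" "\<And>x. x \<in> \<sigma> \<Longrightarrow> \<phi> x = g x"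
    using cut_function assms(1) unfolding cut_function_def rational_function_def by metis
  have g': "\<phi> x = g x" if "x \<in> \<tau>" for x using g(2) that assms(2) by blast
  show 1: "linear (linear_ext \<phi> \<tau>)" by (rule linear_ext_eq(1)[where \<phi>=\<phi>, OF g(1) g'])
  show 2: "x \<in> \<tau> \<Longrightarrow> linear_ext \<phi> \<tau> x = \<phi> x" for x by (rule linear_ext_eq(2)[where \<phi>=\<phi>, OF g(1) g'])
  have 3: "linear (linear_ext \<phi> \<sigma>)" by (rule linear_ext_eq(1)[where \<phi>=\<phi>, OF g])
  have 4: "x \<in> \<sigma> \<Longrightarrow> linear_ext \<phi> \<sigma> x = \<phi> x" for x by (rule linear_ext_eq(2)[where \<phi>=\<phi>, OF g])
  show "linear_ext \<phi> \<sigma> x = linear_ext \<phi> \<tau> x" if "x \<in> span \<tau>"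
    using 2 4 assms(2) by (intro linear_eq_on_span[OF 3 1 _ that]) auto
qed

text \<open>\<open>Gs\<close> is either a flag or a flag with a gap. For \<open>UNIV\<close> and
  sign -1 the value comes from the sign rule in \<open>cut_function\<close>; for \<open>{}\<close>
  it is 0, in agreement with \<open>{}\<close> not being in \<open>B\<close>.\<close>

lemma linear_ext_char_vec:
  assumes "s \<in> {1, -1}" "maximal_flag R Fs" "set Gs \<subseteq> set Fs" "G \<in> set Gs"
  shows "linear_ext \<phi> (flag_cone s Gs) (char_vec G) = - of_bool (G \<in> B)"
proof -
  have \<sigma>: "flag_cone s Fs \<in> cones X" using assms unfolding cones by blast
  have sub: "flag_cone s Gs \<subseteq> flag_cone s Fs"
    unfolding flag_cone_def using assms(3) by (intro hull_mono) auto
  note ext = linear_ext_facet(1,2)[OF \<sigma> sub]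
  have \<phi>: "\<phi> (char_vec G) = - of_bool (G \<in> B)" if "G \<noteq> {}"
  proof -
    have "G \<in> \<G>" using maximal_flag_carrier[OF assms(2)] assms(3,4) by blast
    with that cut_function show ?thesis unfolding cut_function_def B_def by simp
  qed
  consider "G = {}" | "G = UNIV" | "G \<noteq> {}" "G \<noteq> UNIV" by blast
  then show ?thesis
  proof cases
    case 1
    then show ?thesis using linear_0[OF ext(1)] by (simp add: char_vec_empty B_def)
  next
    case 2
    have "\<phi> (s *\<^sub>R char_vec UNIV) = s * \<phi> (char_vec UNIV)"
      using assms(1) cut_function unfolding cut_function_def by auto
    moreover have "linear_ext \<phi> (flag_cone s Gs) (s *\<^sub>R char_vec UNIV) = \<phi> (s *\<^sub>R char_vec UNIV)"
      by (rule ext(2)) (rule signed_UNIV_in_flag_cone)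
    ultimately show ?thesis
      using 2 \<phi> assms(1) by (auto simp: linear_scale[OF ext(1)])
  next
    case 3
    then show ?thesis using ext(2)[OF char_vec_in_flag_cone[OF assms(4)]] \<phi> by simp
  qed
qed

lemma weil_divisor_base:
  assumes "maximal_flag R Fs"
  shows "weight (weil_divisor \<phi> X) (base_cone Fs) = 0"
proof -
  let ?\<tau> = "base_cone Fs"
  \<comment> \<open>\<open>?t s\<close> measures how far the chosen primitive vector is from the
    signed ray. It lies in the span of the facet, where the extensions from both cones
    agree.\<close>
  let ?t = "\<lambda>s. primitive_vec (flag_cone s Fs) ?\<tau> - s *\<^sub>R char_vec UNIV"
  let ?W = "real_of_int (flag_weight \<omega> Fs)"
  have facet: "flag_cone s Fs \<in> cones X" "?\<tau> \<subseteq> flag_cone s Fs" if "s \<in> {1, -1}" for s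
    using that assms facet_of_imp_subset[OF base_facet[OF assms that]] unfolding cones by blast+
  have lin: "linear (linear_ext \<phi> ?\<tau>)" using linear_ext_facet(1)[OF facet[of 1]] by simp
  have val: "linear_ext \<phi> (flag_cone s Fs) (primitive_vec (flag_cone s Fs) ?\<tau>) =
      s * - of_bool (UNIV \<in> B) + linear_ext \<phi> ?\<tau> (?t s)" if "s \<in> {1, -1}" for s
  proof -
    have lin\<sigma>: "linear (linear_ext \<phi> (flag_cone s Fs))"
      using linear_ext_facet(1)[OF facet(1)[OF that]] by blast
    have "linear_ext \<phi> (flag_cone s Fs) (primitive_vec (flag_cone s Fs) ?\<tau>) =
        linear_ext \<phi> (flag_cone s Fs) (s *\<^sub>R char_vec UNIV + ?t s)" by simp
    also have "\<dots> = s * linear_ext \<phi> (flag_cone s Fs) (char_vec UNIV) +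
        linear_ext \<phi> (flag_cone s Fs) (?t s)"
      by (simp only: linear_add[OF lin\<sigma>] linear_scale[OF lin\<sigma>] real_scaleR_def)
    finally show ?thesis
      using linear_ext_char_vec[OF that assms subset_refl maximal_flag_contains(2)[OF assms]]
        linear_ext_facet(3)[OF facet[OF that] primitive_vec_base[OF assms that]] by simp
  qed
  have "star_sum ?\<tau> = ?W *\<^sub>R (?t 1 + ?t (-1))"
    unfolding star_sum_def star_base(1)[OF assms] using star_base(2)[OF assms] assms
    by (simp add: weight scaleR_add_right scaleR_diff_right)
  then have "linear_ext \<phi> ?\<tau> (star_sum ?\<tau>) = ?W * (linear_ext \<phi> ?\<tau> (?t 1) + linear_ext \<phi> ?\<tau> (?t (-1)))"
    by (simp only: linear_add[OF lin] linear_scale[OF lin] real_scaleR_def)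
  moreover have "(\<Sum>\<sigma>\<in>star X ?\<tau>. weight X \<sigma> * linear_ext \<phi> \<sigma> (primitive_vec \<sigma> ?\<tau>)) =
      ?W * (linear_ext \<phi> (flag_cone 1 Fs) (primitive_vec (flag_cone 1 Fs) ?\<tau>) +
        linear_ext \<phi> (flag_cone (-1) Fs) (primitive_vec (flag_cone (-1) Fs) ?\<tau>))"
    unfolding star_base(1)[OF assms] using star_base(2)[OF assms] assms
    by (simp add: weight distrib_left)
  moreover have "linear_ext \<phi> (flag_cone 1 Fs) (primitive_vec (flag_cone 1 Fs) ?\<tau>) +
      linear_ext \<phi> (flag_cone (-1) Fs) (primitive_vec (flag_cone (-1) Fs) ?\<tau>) =
      linear_ext \<phi> ?\<tau> (?t 1) + linear_ext \<phi> ?\<tau> (?t (-1))"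
    using val[of 1] val[of "-1"] by simp
  ultimately show ?thesis
    unfolding weil_divisor_def star_sum_def by simp
qed

lemma weil_divisor_gap:
  assumes "maximal_flag R (As @ F # G0 # F' # Bs)" "s \<in> {1, -1}"
  shows "weight (weil_divisor \<phi> X) (flag_cone s (As @ F # F' # Bs)) =
    (if F \<notin> B \<and> F' \<in> B
     then of_int (flag_weight \<omega> (As @ [F]) * flag_weight \<omega> (F' # Bs) * jump_weight F F') else 0)"
proof -
  let ?\<tau> = "flag_cone s (As @ F # F' # Bs)"
  let ?\<sigma> = "\<lambda>G. flag_cone s (As @ F # G # F' # Bs)"
  let ?P = "flag_weight \<omega> (As @ [F]) * flag_weight \<omega> (F' # Bs)"
  define c where "c G = real_of_int (?P * (\<omega> F G * \<omega> G F'))" for G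
  define t where "t G = primitive_vec (?\<sigma> G) ?\<tau> - char_vec G" for G
  \<comment> \<open>In view of balancing, the total weight \<open>W\<close> and the coordinate
    \<open>D\<close> on \<open>F' - F\<close> determine the whole weighted sum of the e_G.\<close>
  define W where "W = (\<Sum>G\<in>between F F'. c G)"
  define D where "D = (\<Sum>G\<in>between F F'. of_bool (selected F F' \<in> G) * c G)"
  note max = star_gap(3)[OF assms]
  have sub: "F \<subset> F'"
    using assms(1) covers_psubset[of F G0] covers_psubset[of G0 F']
    unfolding maximal_flag_eq_chain chain_between_insert by blast
  then have sel: "selected F F' \<in> F' - F"
    unfolding selected_def by (metis Diff_eq_empty_iff ex_in_conv psubsetE someI_ex)
  have facet: "?\<sigma> G \<in> cones X" "?\<tau> \<subseteq> ?\<sigma> G" "t G \<in> span ?\<tau>" if "G \<in> between F F'" for G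
    using that assms(2) facet_of_imp_subset[OF gap_facet[OF max assms(2)]] max
      primitive_vec_gap[OF max assms(2)] unfolding cones t_def by blast+
  have G0: "G0 \<in> between F F'"
    using assms(1) unfolding maximal_flag_eq_chain chain_between_insert by blast
  have lin: "linear (linear_ext \<phi> ?\<tau>)" by (rule linear_ext_facet(1)[OF facet(1,2)[OF G0]])
  have val: "linear_ext \<phi> (?\<sigma> G) (primitive_vec (?\<sigma> G) ?\<tau>) =
      - of_bool (G \<in> B) + linear_ext \<phi> ?\<tau> (t G)" if G: "G \<in> between F F'" for G
  proof -
    have lin\<sigma>: "linear (linear_ext \<phi> (?\<sigma> G))"
      by (rule linear_ext_facet(1)[OF facet(1)[OF G] subset_refl])
    have "linear_ext \<phi> (?\<sigma> G) (char_vec G + t G) =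
        linear_ext \<phi> (?\<sigma> G) (char_vec G) + linear_ext \<phi> (?\<sigma> G) (t G)"
      by (rule linear_add[OF lin\<sigma>])
    moreover have "linear_ext \<phi> (?\<sigma> G) (char_vec G) = - of_bool (G \<in> B)"
      using G by (intro linear_ext_char_vec[OF assms(2) max]) auto
    ultimately show ?thesis
      using linear_ext_facet(3)[OF facet[OF G]] by (simp add: t_def)
  qed
  have S: "star_sum ?\<tau> = (\<Sum>G\<in>between F F'. c G *\<^sub>R char_vec G) + (\<Sum>G\<in>between F F'. c G *\<^sub>R t G)"
    unfolding star_sum_def sum_star_gap[OF assms, of "\<lambda>w \<sigma>. w *\<^sub>R primitive_vec \<sigma> ?\<tau>"] c_def t_def
    by (simp add: sum.distrib[symmetric] scaleR_diff_right)
  have "(\<Sum>G\<in>between F F'. c G *\<^sub>R char_vec G) = star_sum ?\<tau> - (\<Sum>G\<in>between F F'. c G *\<^sub>R t G)"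
    using S by simp
  also have "\<dots> \<in> span ?\<tau>"
    using facet(3) balanced[of ?\<tau>] G0 unfolding star_gap(1)[OF assms]
    by (intro span_diff span_sum span_scale) auto
  finally have in_span: "(\<Sum>G\<in>between F F'. c G *\<^sub>R char_vec G) \<in> span ?\<tau>" .
  have D_nth: "(\<Sum>G\<in>between F F'. c G *\<^sub>R char_vec G) $ selected F F' = D"
    unfolding D_def by (simp add: mult.commute)
  have "(\<Sum>G\<in>between F F'. c G *\<^sub>R char_vec G) = (W - D) *\<^sub>R char_vec F + D *\<^sub>R char_vec F'"
    unfolding W_def D_nth[symmetric] using sub span_gap_const[OF assms(1) in_span _ sel]
    by (intro gap_sum_eq) blast+
  moreover have "linear_ext \<phi> ?\<tau> (char_vec F) = - of_bool (F \<in> B)"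
    "linear_ext \<phi> ?\<tau> (char_vec F') = - of_bool (F' \<in> B)"
    by (rule linear_ext_char_vec[OF assms(2,1)]; auto)+
  ultimately have "linear_ext \<phi> ?\<tau> (\<Sum>G\<in>between F F'. c G *\<^sub>R char_vec G) =
      - ((W - D) * of_bool (F \<in> B) + D * of_bool (F' \<in> B))"
    by (simp add: linear_add[OF lin] linear_scale[OF lin])
  then have "linear_ext \<phi> ?\<tau> (star_sum ?\<tau>) = - ((W - D) * of_bool (F \<in> B) + D * of_bool (F' \<in> B)) +
      (\<Sum>G\<in>between F F'. c G * linear_ext \<phi> ?\<tau> (t G))"
    unfolding S by (simp add: linear_add[OF lin] linear_sum[OF lin] linear_scale[OF lin])
  moreover have "(\<Sum>\<sigma>\<in>star X ?\<tau>. weight X \<sigma> * linear_ext \<phi> \<sigma> (primitive_vec \<sigma> ?\<tau>)) =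
      (\<Sum>G\<in>between F F'. c G * (- of_bool (G \<in> B) + linear_ext \<phi> ?\<tau> (t G)))"
    unfolding sum_star_gap[OF assms, of "\<lambda>w \<sigma>. w * linear_ext \<phi> \<sigma> (primitive_vec \<sigma> ?\<tau>)"] c_def[symmetric]
    using val by (intro sum.cong) auto
  \<comment> \<open>The values at the \<open>t G\<close> occur in both halves of the divisor formula
    and cancel.\<close>
  ultimately have weil: "weight (weil_divisor \<phi> X) ?\<tau> = (W - D) * of_bool (F \<in> B) + D * of_bool (F' \<in> B) -
      (\<Sum>G\<in>between F F'. of_bool (G \<in> B) * c G)"
    unfolding weil_divisor_def star_sum_def
    by (simp add: sum.distrib sum_subtractf sum_negf algebra_simps)
  consider "F \<in> B" | "F' \<notin> B" | "F \<notin> B" "F' \<in> B" by blast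
  then show ?thesis
  proof cases
    case 1
    then have "G \<in> B" if "G \<in> between F F'" for G
      using that covers_B by blast
    then have "(\<Sum>G\<in>between F F'. of_bool (G \<in> B) * c G) = W" unfolding W_def by (intro sum.cong) auto
    moreover have "F' \<in> B" using 1 G0 covers_B by blast
    ultimately show ?thesis using weil 1 by simp
  next
    case 2
    then have "G \<notin> B" if "G \<in> between F F'" for G
      using that covers_B by blast
    then have "(\<Sum>G\<in>between F F'. of_bool (G \<in> B) * c G) = 0" by (intro sum.neutral) auto
    moreover have "F \<notin> B" using 2 G0 covers_B by blast
    ultimately show ?thesis using weil 2 by simp
  next
    case 3
    then show ?thesis
      using weil unfolding D_def jump_weight_def c_def
      by (simp add: sum_distrib_left sum_subtractf[symmetric] algebra_simps)
  qed
qed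

end

section \<open>Two-step balancing\<close>

text \<open>A set of edges that all raise a rank by one is exactly the covering relation of the
  order it generates, because a set strictly in between would raise the rank by at least
  two.\<close>

lemma ranked_set_poset_generated:
  fixes \<rho> :: "'e::finite set \<Rightarrow> nat"
  assumes "C \<subseteq> \<G> \<times> \<G>" "{} \<in> \<G>" "UNIV \<in> \<G>"
    and sub: "\<And>F F'. (F, F') \<in> C \<Longrightarrow> F \<subset> F'"
    and rank: "\<And>F F'. (F, F') \<in> C \<Longrightarrow> \<rho> F' = Suc (\<rho> F)"
  shows "covers (Id_on \<G> \<union> C\<^sup>+) F F' \<longleftrightarrow> (F, F') \<in> C"
    and "ranked_set_poset \<G> (Id_on \<G> \<union> C\<^sup>+)"
proof -
  have sub': "F \<subset> F'" if "(F, F') \<in> C\<^sup>+" for F F'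
    using that by (induction rule: trancl_induct) (use sub in blast)+
  have rank': "\<rho> F < \<rho> F'" if "(F, F') \<in> C\<^sup>+" for F F'
    using that by (induction rule: trancl_induct) (use rank in force)+
  show covers_iff: "covers (Id_on \<G> \<union> C\<^sup>+) F F' \<longleftrightarrow> (F, F') \<in> C" for F F'
  proof
    assume cov: "covers (Id_on \<G> \<union> C\<^sup>+) F F'"
    then have "(F, F') \<in> C\<^sup>+" unfolding covers_def by blast
    then show "(F, F') \<in> C"
    proof (rule converse_tranclE)
      fix H assume "(F, H) \<in> C" "(H, F') \<in> C\<^sup>+"
      then show ?thesis using cov sub' sub unfolding covers_def by blast
    qed
  next
    assume C: "(F, F') \<in> C"
    have False if "(F, H) \<in> C\<^sup>+" "(H, F') \<in> C\<^sup>+" for H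
      using rank'[OF that(1)] rank'[OF that(2)] rank[OF C] by linarith
    then show "covers (Id_on \<G> \<union> C\<^sup>+) F F'"
      using C sub unfolding covers_def by blast
  qed
  have "C\<^sup>+ \<subseteq> \<G> \<times> \<G>" using assms(1) by (rule trancl_subset_Sigma)
  moreover have "trans (Id_on \<G> \<union> C\<^sup>+)"
    by (intro transI) (auto intro: trancl_trans)
  moreover have "antisym (Id_on \<G> \<union> C\<^sup>+)"
    using sub' by (intro antisymI) blast
  ultimately have "partial_order_on \<G> (Id_on \<G> \<union> C\<^sup>+)"
    unfolding partial_order_on_def preorder_on_def by (auto simp: refl_on_def)
  then show "ranked_set_poset \<G> (Id_on \<G> \<union> C\<^sup>+)"
    unfolding ranked_set_poset_def covers_iff using assms(2,3) sub' rank by (auto; metis psubset_imp_subset)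
qed

text \<open>
  \<open>w x y\<close> is the weight of the flag \<open>F \<subset> x \<subset> y \<subset> F'\<close>, where \<open>F\<close> and \<open>F'\<close> have rank difference three;
  \<open>a y\<close> and \<open>b x\<close> are the constants in the balancing conditions of the intervals \<open>[F, y]\<close> and \<open>[x, F']\<close>.
\<close>

lemma two_step_balancing:
  fixes w :: "'e::finite set \<Rightarrow> 'e set \<Rightarrow> int" and B :: "'e set set"
  assumes sub: "\<And>x y. w x y \<noteq> 0 \<Longrightarrow> x \<subseteq> y"
    and up: "\<And>x y. w x y \<noteq> 0 \<Longrightarrow> x \<in> B \<Longrightarrow> y \<in> B"
    and a: "\<And>e y. e \<in> F' - F \<Longrightarrow> e \<in> y \<Longrightarrow> (\<Sum>x\<in>UNIV. of_bool (e \<in> x) * w x y) = a y"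
    and b: "\<And>e x. e \<in> F' - F \<Longrightarrow> e \<notin> x \<Longrightarrow> (\<Sum>y\<in>UNIV. of_bool (e \<in> y) * w x y) = b x"
  defines "T \<equiv> \<lambda>e. \<Sum>H\<in>UNIV. of_bool (e \<in> H) *
      (if H \<in> B then a H - (\<Sum>x\<in>UNIV. of_bool (x \<in> B) * w x H)
       else b H - (\<Sum>y\<in>UNIV. of_bool (y \<in> B) * w H y))"
  assumes e: "e \<in> F' - F" and d: "d \<in> F' - F"
  shows "T e = T d"
proof -
  \<comment> \<open>Extends the balancing of [F, y] to all \<open>y\<close>: if \<open>e\<close> is
    not in \<open>y\<close>, it is in no \<open>x\<close> below \<open>y\<close>, and both sides
    vanish.\<close>
  have a': "of_bool (e \<in> y) * a y = (\<Sum>x\<in>UNIV. of_bool (e \<in> x) * w x y)" if "e \<in> F' - F" for e y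
  proof (cases "e \<in> y")
    case True
    then show ?thesis using a[OF that] by simp
  next
    case False
    then have "of_bool (e \<in> x) * w x y = 0" for x using sub[of x y] by auto
    then show ?thesis using False by (simp add: sum.neutral)
  qed
  have b': "of_bool (e \<notin> x) * b x = (\<Sum>y\<in>UNIV. of_bool (e \<notin> x \<and> e \<in> y) * w x y)"
    if "e \<in> F' - F" for e x
    using b[OF that, of x] by (cases "e \<in> x") simp_all
  \<comment> \<open>The cut enters only through a term free of \<open>e\<close>. For
    \<open>x\<close> outside \<open>B\<close> the terms in \<open>w x y\<close> cancel. For
    \<open>x\<close> in \<open>B\<close> also \<open>y\<close> is in \<open>B\<close>, and what
    remains is minus the indicator that \<open>e\<close> is in \<open>y\<close> but not in
    \<open>x\<close>; summed over \<open>y\<close> this is again \<open>b x\<close>.\<close>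
  have T: "T e = (\<Sum>x\<in>UNIV. of_bool (e \<in> x) * b x) - (\<Sum>x\<in>UNIV. of_bool (x \<in> B) * b x)"
    if e: "e \<in> F' - F" for e
  proof -
    have "T e = (\<Sum>H\<in>UNIV. of_bool (e \<in> H \<and> H \<notin> B) * b H
          - (\<Sum>y\<in>UNIV. of_bool (e \<in> H \<and> H \<notin> B \<and> y \<in> B) * w H y)
          + (of_bool (H \<in> B) * (of_bool (e \<in> H) * a H)
          - (\<Sum>x\<in>UNIV. of_bool (e \<in> H \<and> H \<in> B \<and> x \<in> B) * w x H)))"
      unfolding T_def by (intro sum.cong) (auto intro!: sum.cong)
    also have "\<dots> = (\<Sum>H\<in>UNIV. of_bool (e \<in> H \<and> H \<notin> B) * b H)
          - (\<Sum>x\<in>UNIV. \<Sum>y\<in>UNIV. of_bool (e \<in> x \<and> x \<notin> B \<and> y \<in> B) * w x y)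
          + ((\<Sum>y\<in>UNIV. \<Sum>x\<in>UNIV. of_bool (y \<in> B) * (of_bool (e \<in> x) * w x y))
          - (\<Sum>y\<in>UNIV. \<Sum>x\<in>UNIV. of_bool (e \<in> y \<and> y \<in> B \<and> x \<in> B) * w x y))"
      unfolding a'[OF e] by (simp only: sum.distrib sum_subtractf sum_distrib_left)
    also have "\<dots> = (\<Sum>H\<in>UNIV. of_bool (e \<in> H \<and> H \<notin> B) * b H)
          - (\<Sum>x\<in>UNIV. \<Sum>y\<in>UNIV. of_bool (e \<in> x \<and> x \<notin> B \<and> y \<in> B) * w x y)
          + ((\<Sum>x\<in>UNIV. \<Sum>y\<in>UNIV. of_bool (y \<in> B) * (of_bool (e \<in> x) * w x y))
          - (\<Sum>x\<in>UNIV. \<Sum>y\<in>UNIV. of_bool (e \<in> y \<and> y \<in> B \<and> x \<in> B) * w x y))"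
    proof -
      note sum.swap[of "\<lambda>y x. of_bool (y \<in> B) * (of_bool (e \<in> x) * w x y)" UNIV UNIV]
      moreover note sum.swap[of "\<lambda>y x. of_bool (e \<in> y \<and> y \<in> B \<and> x \<in> B) * w x y" UNIV UNIV]
      ultimately show ?thesis by argo
    qed
    also have "\<dots> = (\<Sum>H\<in>UNIV. of_bool (e \<in> H \<and> H \<notin> B) * b H)
          + (\<Sum>x\<in>UNIV. \<Sum>y\<in>UNIV. of_bool (y \<in> B) * (of_bool (e \<in> x) * w x y)
            - of_bool (e \<in> x \<and> x \<notin> B \<and> y \<in> B) * w x y
            - of_bool (e \<in> y \<and> y \<in> B \<and> x \<in> B) * w x y)"
      by (simp only: sum_subtractf)
    also have "(\<Sum>x\<in>UNIV. \<Sum>y\<in>UNIV. of_bool (y \<in> B) * (of_bool (e \<in> x) * w x y)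
            - of_bool (e \<in> x \<and> x \<notin> B \<and> y \<in> B) * w x y
            - of_bool (e \<in> y \<and> y \<in> B \<and> x \<in> B) * w x y) =
        (\<Sum>x\<in>UNIV. \<Sum>y\<in>UNIV. - (of_bool (x \<in> B) * (of_bool (e \<notin> x \<and> e \<in> y) * w x y)))"
    proof (intro sum.cong refl)
      fix x y
      show "of_bool (y \<in> B) * (of_bool (e \<in> x) * w x y)
            - of_bool (e \<in> x \<and> x \<notin> B \<and> y \<in> B) * w x y
            - of_bool (e \<in> y \<and> y \<in> B \<and> x \<in> B) * w x y =
          - (of_bool (x \<in> B) * (of_bool (e \<notin> x \<and> e \<in> y) * w x y))"
        using sub[of x y] up[of x y] by (cases "w x y = 0") (auto simp: of_bool_def)
    qed
    also have "\<dots> = (\<Sum>x\<in>UNIV. - (of_bool (x \<in> B) * (of_bool (e \<notin> x) * b x)))"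
      unfolding b'[OF e] by (simp only: sum_negf sum_distrib_left)
    also have "(\<Sum>H\<in>UNIV. of_bool (e \<in> H \<and> H \<notin> B) * b H) + \<dots> =
        (\<Sum>x\<in>UNIV. of_bool (e \<in> x) * b x - of_bool (x \<in> B) * b x)"
      unfolding sum.distrib[symmetric] by (intro sum.cong) auto
    finally show ?thesis by (simp only: sum_subtractf)
  qed
  \<comment> \<open>Splitting by whether \<open>d\<close> is in \<open>x\<close>, then evaluating
    \<open>b\<close> at \<open>d\<close> and \<open>a\<close> at \<open>e\<close>, leaves an
    expression symmetric in \<open>e\<close> and \<open>d\<close>.\<close>
  have sym: "(\<Sum>x\<in>UNIV. of_bool (e \<in> x) * b x) =
      (\<Sum>x\<in>UNIV. of_bool (e \<in> x \<and> d \<in> x) * b x) +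
      (\<Sum>y\<in>UNIV. of_bool (e \<in> y \<and> d \<in> y) * a y - (\<Sum>x\<in>UNIV. of_bool (e \<in> x \<and> d \<in> x) * w x y))"
    if e: "e \<in> F' - F" and d: "d \<in> F' - F" for e d
  proof -
    have "(\<Sum>x\<in>UNIV. of_bool (e \<in> x) * b x) =
        (\<Sum>x\<in>UNIV. of_bool (e \<in> x \<and> d \<in> x) * b x + of_bool (e \<in> x) * (of_bool (d \<notin> x) * b x))"
      by (intro sum.cong) auto
    also have "\<dots> = (\<Sum>x\<in>UNIV. of_bool (e \<in> x \<and> d \<in> x) * b x) +
        (\<Sum>x\<in>UNIV. \<Sum>y\<in>UNIV. of_bool (e \<in> x) * (of_bool (d \<notin> x \<and> d \<in> y) * w x y))"
      unfolding b'[OF d] by (simp only: sum.distrib sum_distrib_left)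
    also have "(\<Sum>x\<in>UNIV. \<Sum>y\<in>UNIV. of_bool (e \<in> x) * (of_bool (d \<notin> x \<and> d \<in> y) * w x y)) =
        (\<Sum>y\<in>UNIV. \<Sum>x\<in>UNIV. of_bool (d \<in> y) * (of_bool (e \<in> x) * w x y) - of_bool (e \<in> x \<and> d \<in> x) * w x y)"
    proof (subst sum.swap, intro sum.cong refl)
      fix x y
      show "of_bool (e \<in> x) * (of_bool (d \<notin> x \<and> d \<in> y) * w x y) =
          of_bool (d \<in> y) * (of_bool (e \<in> x) * w x y) - of_bool (e \<in> x \<and> d \<in> x) * w x y"
        using sub[of x y] by (cases "w x y = 0") (auto simp: of_bool_def)
    qed
    also have "\<dots> = (\<Sum>y\<in>UNIV. of_bool (d \<in> y) * (of_bool (e \<in> y) * a y) - (\<Sum>x\<in>UNIV. of_bool (e \<in> x \<and> d \<in> x) * w x y))"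
      unfolding a'[OF e] by (simp only: sum_subtractf sum_distrib_left)
    also have "\<dots> = (\<Sum>y\<in>UNIV. of_bool (e \<in> y \<and> d \<in> y) * a y - (\<Sum>x\<in>UNIV. of_bool (e \<in> x \<and> d \<in> x) * w x y))"
      by (intro sum.cong) auto
    finally show ?thesis .
  qed
  have "(\<Sum>x\<in>UNIV. of_bool (e \<in> x) * b x) = (\<Sum>x\<in>UNIV. of_bool (d \<in> x) * b x)"
    unfolding sym[OF e d] sym[OF d e] by (simp add: conj_commute)
  then show ?thesis unfolding T[OF e] T[OF d] by simp
qed

lemma chain_between_crossing:
  assumes "chain_between P x y xs" "\<not> Q x" "Q y"
  obtains As F F' Bs where "xs = As @ F # F' # Bs" "\<not> Q F" "Q F'"
  using assms
proof (induction xs arbitrary: x thesis)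
  case (Cons z zs)
  show ?case
  proof (cases zs)
    case Nil then show ?thesis using Cons.prems by auto
  next
    case (Cons z' zs')
    then have x: "x = z" "chain_between P z' y zs" using Cons.prems(2) by (auto simp: chain_between_Cons)
    show ?thesis
    proof (cases "Q z'")
      case True
      then show ?thesis using Cons.prems(1)[of "[]" z z' zs'] Cons.prems(3) Cons x by simp
    next
      case False
      obtain As F F' Bs where "zs = As @ F # F' # Bs" "\<not> Q F" "Q F'"
        using Cons.IH[OF _ x(2) False Cons.prems(4)] by blast
      then show ?thesis using Cons.prems(1)[of "z # As" F F' Bs] by simp
    qed
  qed
qed (simp add: chain_between_def)

context flag_poset
begin

lemma supported_refl: "supported \<omega> F F"
  unfolding supported_def by (intro exI[of _ "[F]"]) simp

lemma supported_Cons: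
  assumes "covers R F G" "\<omega> F G \<noteq> 0" "supported \<omega> G F'"
  shows "supported \<omega> F F'"
proof -
  obtain xs where xs: "chain_between (covers R) G F' xs" "flag_weight \<omega> xs \<noteq> 0"
    using assms(3) unfolding supported_def by blast
  then obtain ys where "xs = G # ys" unfolding chain_between_def by (cases xs) auto
  with xs assms(1,2) show ?thesis
    unfolding supported_def by (intro exI[of _ "F # G # ys"]) (simp add: chain_between_Cons)
qed

lemma supported_snoc:
  assumes "supported \<omega> F G" "covers R G F'" "\<omega> G F' \<noteq> 0"
  shows "supported \<omega> F F'"
proof -
  obtain xs where xs: "chain_between (covers R) F G xs" "flag_weight \<omega> xs \<noteq> 0"
    using assms(1) unfolding supported_def by blast
  then have "xs \<noteq> []" "last xs = G" unfolding chain_between_def by simp_all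
  then have "xs = butlast xs @ [G]" by (metis append_butlast_last_id)
  then obtain ys where "xs = ys @ [G]" ..
  then have "chain_between (covers R) F F' (ys @ G # F' # [])"
    using xs(1) assms(2) unfolding chain_between_insert2 by simp
  moreover have "flag_weight \<omega> (ys @ G # F' # []) \<noteq> 0"
    using xs(2) assms(3) \<open>xs = ys @ [G]\<close> unfolding flag_weight_append[of \<omega> ys G "[F']"] by simp
  ultimately show ?thesis unfolding supported_def by blast
qed

end

section \<open>The Flag fan of the divisor\<close>

context cut_fan
begin

text \<open>
  The condition \<open>UNIV \<in> B\<close> leaves no flags at all for the empty cut, whose divisor is zero.
\<close>

definition cut_covers :: "('e set \<times> 'e set) set" where
  "cut_covers = {(F, F'). UNIV \<in> B \<and>
     (covers R F F' \<and> (F \<in> B \<longleftrightarrow> F' \<in> B) \<or> F \<notin> B \<and> F' \<in> B \<and> between F F' \<noteq> {})}"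

definition cut_order :: "('e set \<times> 'e set) set" where
  "cut_order = Id_on \<G> \<union> cut_covers\<^sup>+"

definition cut_weight :: "'e set \<Rightarrow> 'e set \<Rightarrow> int" where
  "cut_weight F F' = (if F \<in> B \<longleftrightarrow> F' \<in> B then \<omega> F F' else jump_weight F F')"

text \<open>The weights are copied from the Weil divisor, so that comparing the two fans only
  concerns their cones; that the weights are products of edge weights is proved in
  \<open>weight_cut_divisor\<close>.\<close>

definition cut_divisor :: "(real ^ 'e) weighted_fan" where
  "cut_divisor = \<lparr> cones = {flag_cone s Fs | s Fs. s \<in> {1, -1} \<and> maximal_flag cut_order Fs},
     weight = weight (weil_divisor \<phi> X) \<rparr>"

lemma cut_covers_iff: "covers cut_order F F' \<longleftrightarrow> (F, F') \<in> cut_covers"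
  and ranked_cut_order: "ranked_set_poset \<G> cut_order"
proof -
  have "\<exists>\<rho> :: 'e set \<Rightarrow> nat. \<forall>F F'. covers R F F' \<longrightarrow> \<rho> F' = Suc (\<rho> F)"
    using ranked unfolding ranked_set_poset_def by (elim conjE)
  then obtain \<rho> :: "'e set \<Rightarrow> nat" where \<rho>: "\<And>F F'. covers R F F' \<Longrightarrow> \<rho> F' = Suc (\<rho> F)"
    by auto
  have 1: "cut_covers \<subseteq> \<G> \<times> \<G>"
    unfolding cut_covers_def using covers_carrier by blast
  have 2: "F \<subset> F'" if "(F, F') \<in> cut_covers" for F F'
    using that covers_psubset unfolding cut_covers_def by blast
  \<comment> \<open>Along a crossing edge \<rho> rises by two and the second summand falls from one
    to zero.\<close>
  define \<rho>' where "\<rho>' F = \<rho> F + of_bool (F \<notin> B)" for F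
  have 3: "\<rho>' F' = Suc (\<rho>' F)" if "(F, F') \<in> cut_covers" for F F'
    using that \<rho> unfolding cut_covers_def \<rho>'_def by (auto simp: of_bool_def)
  have 4: "{} \<in> \<G>" "UNIV \<in> \<G>" using ranked unfolding ranked_set_poset_def by blast+
  show "covers cut_order F F' \<longleftrightarrow> (F, F') \<in> cut_covers"
    unfolding cut_order_def by (rule ranked_set_poset_generated(1)[OF 1 4, of \<rho>']) (fact 2 3)+
  show "ranked_set_poset \<G> cut_order"
    unfolding cut_order_def by (rule ranked_set_poset_generated(2)[OF 1 4, of \<rho>']) (fact 2 3)+
qed

sublocale cut: flag_poset \<G> cut_order
  by unfold_locales (rule ranked_cut_order)

section \<open>Chains and flags of the new order\<close>

lemma B_UNIV: "F \<in> B \<Longrightarrow> UNIV \<in> B"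
  using B_upward[of F UNIV] ranked unfolding ranked_set_poset_def by blast

lemma cut_covers_upper: "F \<in> B \<Longrightarrow> covers cut_order F F' \<longleftrightarrow> covers R F F'"
  unfolding cut_covers_iff cut_covers_def using covers_B B_UNIV by blast

lemma cut_covers_lower: "F' \<notin> B \<Longrightarrow> UNIV \<in> B \<Longrightarrow> covers cut_order F F' \<longleftrightarrow> covers R F F'"
  unfolding cut_covers_iff cut_covers_def using covers_B by blast

lemma cut_covers_cross:
  "F \<notin> B \<Longrightarrow> F' \<in> B \<Longrightarrow> covers cut_order F F' \<longleftrightarrow> between F F' \<noteq> {}"
  unfolding cut_covers_iff cut_covers_def using B_UNIV by blast

lemma cut_covers_B: "covers cut_order F F' \<Longrightarrow> F \<in> B \<Longrightarrow> F' \<in> B"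
  unfolding cut_covers_iff cut_covers_def by blast

text \<open>A chain that starts in \<open>B\<close> stays there, so it never meets a crossing edge,
  and the two orders and weights agree on it.\<close>

lemma chain_upper:
  assumes "F \<in> B"
  shows "chain_between (covers cut_order) F F' xs \<longleftrightarrow> chain_between (covers R) F F' xs"
    and "chain_between (covers R) F F' xs \<Longrightarrow> flag_weight cut_weight xs = flag_weight \<omega> xs \<and> F' \<in> B"
proof -
  show "chain_between (covers cut_order) F F' xs \<longleftrightarrow> chain_between (covers R) F F' xs"
    using assms
  proof (induction xs arbitrary: F)
    case (Cons x xs)
    then show ?case
      by (cases xs) (auto simp: chain_between_Cons cut_covers_upper covers_B)
  qed (simp add: chain_between_def)
  show "chain_between (covers R) F F' xs \<Longrightarrow> flag_weight cut_weight xs = flag_weight \<omega> xs \<and> F' \<in> B"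
    using assms
  proof (induction xs arbitrary: F)
    case (Cons x xs)
    then show ?case
      by (cases xs) (auto simp: chain_between_Cons cut_weight_def covers_B)
  qed (simp add: chain_between_def)
qed

lemma chain_lower_start: "chain_between (covers R) F F' xs \<Longrightarrow> F' \<notin> B \<Longrightarrow> F \<notin> B"
  using chain_upper(2) by blast

lemma chain_lower:
  assumes "F' \<notin> B" "UNIV \<in> B"
  shows "chain_between (covers cut_order) F F' xs \<longleftrightarrow> chain_between (covers R) F F' xs"
    and "chain_between (covers R) F F' xs \<Longrightarrow> flag_weight cut_weight xs = flag_weight \<omega> xs"
proof -
  show eq: "chain_between (covers cut_order) F F' xs \<longleftrightarrow> chain_between (covers R) F F' xs"
  proof (induction xs arbitrary: F)
    case (Cons x xs)
    show ?case
    proof (cases xs)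
      case Nil
      then show ?thesis by simp
    next
      case (Cons y ys)
      then show ?thesis
        using Cons.IH[of y] cut_covers_lower[OF _ assms(2), of y x] chain_lower_start[OF _ assms(1)]
        by (auto simp: chain_between_Cons)
    qed
  qed (simp add: chain_between_def)
  show "chain_between (covers R) F F' xs \<Longrightarrow> flag_weight cut_weight xs = flag_weight \<omega> xs"
  proof (induction xs arbitrary: F)
    case (Cons x xs)
    show ?case
    proof (cases xs)
      case (Cons y ys)
      then show ?thesis
        using Cons.IH[of y] Cons.prems chain_lower_start[OF _ assms(1)] covers_B
        by (auto simp: chain_between_Cons cut_weight_def)
    qed simp
  qed (simp add: chain_between_def)
qed

lemma empty_notin_B: "{} \<notin> B"
  unfolding B_def by simp

lemma maximal_flag_cut_UNIV:
  assumes "maximal_flag cut_order Fs"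
  shows "UNIV \<in> B"
proof -
  obtain x y zs where "Fs = x # y # zs"
  \<comment> \<open>The rule merely splits by length zero, one, or at least two; the first two are
    impossible since \<open>{}\<close> and \<open>UNIV\<close> differ.\<close>
  proof (cases Fs rule: remdups_adj.cases)
    case 1 then show ?thesis using assms unfolding maximal_flag_def by simp
  next
    case (2 x) then show ?thesis using assms unfolding maximal_flag_def by auto
  next
    case (3 x y zs) then show ?thesis using that by blast
  qed
  then show ?thesis
    using assms unfolding maximal_flag_def by (simp add: cut_covers_iff cut_covers_def)
qed

lemma maximal_flag_cut_iff:
  assumes "F \<notin> B" "F' \<in> B"
  shows "maximal_flag cut_order (As @ F # F' # Bs) \<longleftrightarrow>
    (\<exists>G. maximal_flag R (As @ F # G # F' # Bs))"
  unfolding maximal_flag_eq_chain chain_between_insert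
    chain_between_insert2[of "covers cut_order"] chain_lower(1)[OF assms(1) B_UNIV[OF assms(2)]]
    chain_upper(1)[OF assms(2)] cut_covers_cross[OF assms] by blast

lemma maximal_flag_cut_cases:
  assumes "maximal_flag cut_order Fs"
  obtains As F G F' Bs where "Fs = As @ F # F' # Bs" "F \<notin> B" "F' \<in> B"
    "maximal_flag R (As @ F # G # F' # Bs)"
proof -
  obtain As F F' Bs where Fs: "Fs = As @ F # F' # Bs" "F \<notin> B" "F' \<in> B"
    using chain_between_crossing[of "covers cut_order" "{}" UNIV Fs "\<lambda>F. F \<in> B"]
      assms empty_notin_B maximal_flag_cut_UNIV[OF assms] unfolding maximal_flag_eq_chain by blast
  obtain G where "maximal_flag R (As @ F # G # F' # Bs)"
    using assms unfolding Fs(1) maximal_flag_cut_iff[OF Fs(2,3)] ..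
  with Fs show thesis by (rule that)
qed

lemma weight_cut_divisor:
  assumes "s \<in> {1, -1}" "maximal_flag cut_order Fs"
  shows "weight cut_divisor (flag_cone s Fs) = of_int (flag_weight cut_weight Fs)"
  using assms(2)
proof (cases rule: maximal_flag_cut_cases)
  case (1 As F G F' Bs)
  have "chain_between (covers R) {} F (As @ [F])" "chain_between (covers R) F' UNIV (F' # Bs)"
    using 1(4) unfolding maximal_flag_eq_chain chain_between_insert by blast+
  then have "flag_weight cut_weight (As @ [F]) = flag_weight \<omega> (As @ [F])"
    "flag_weight cut_weight (F' # Bs) = flag_weight \<omega> (F' # Bs)"
    using chain_lower(2)[OF 1(2) B_UNIV[OF 1(3)]] chain_upper(2)[OF 1(3)] by blast+
  then have "flag_weight cut_weight Fs =
      flag_weight \<omega> (As @ [F]) * flag_weight \<omega> (F' # Bs) * jump_weight F F'"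
    unfolding 1(1) flag_weight_append[of cut_weight As F "F' # Bs"] using 1(2,3)
    by (simp add: cut_weight_def)
  then show ?thesis
    using weil_divisor_gap[OF 1(4) assms(1)] 1(1-3) unfolding cut_divisor_def by simp
qed

section \<open>Balancing of the divisor\<close>

sublocale cut: flag_fan \<G> cut_order cut_divisor cut_weight
  by unfold_locales (simp add: cut_divisor_def, rule weight_cut_divisor)

text \<open>A crossing edge of nonzero weight can be refilled by some \<open>G\<close> with both
  edge weights nonzero. This makes the balancing of \<open>X\<close> available wherever the divisor
  has to be balanced.\<close>

lemma supported_of_cut:
  assumes "cut.supported cut_weight F F'"
  shows "supported \<omega> F F'"
proof -
  obtain xs where "chain_between (covers cut_order) F F' xs" "flag_weight cut_weight xs \<noteq> 0"
    using assms unfolding cut.supported_def by blast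
  then show ?thesis
  proof (induction xs arbitrary: F)
    case (Cons x xs)
    show ?case
    proof (cases xs)
      case Nil
      then show ?thesis using Cons.prems supported_refl by auto
    next
      case (Cons y ys)
      have y: "covers cut_order F y" "cut_weight F y \<noteq> 0" "supported \<omega> y F'"
        using Cons Cons.prems Cons.IH[of y] by (auto simp: chain_between_Cons)
      show ?thesis
      proof (cases "F \<in> B \<longleftrightarrow> y \<in> B")
        case True
        then have "covers R F y" "\<omega> F y \<noteq> 0"
          using y(1,2) unfolding cut_covers_iff cut_covers_def cut_weight_def by auto
        then show ?thesis using y(3) by (rule supported_Cons)
      next
        case False
        then have "jump_weight F y \<noteq> 0" using y(2) unfolding cut_weight_def by simp
        \<comment> \<open>A nonzero sum has a nonzero summand.\<close>
        then obtain G where "G \<in> between F y" "\<omega> F G * \<omega> G y \<noteq> 0"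
          unfolding jump_weight_def by (metis (no_types, lifting) mult_zero_right sum.neutral)
        then show ?thesis using y(3) supported_Cons by auto
      qed
    qed
  qed (simp add: chain_between_def)
qed

lemma jump_weight_empty: "between F F' = {} \<Longrightarrow> jump_weight F F' = 0"
  unfolding jump_weight_def by (simp only: sum.empty)

lemma cut_balanced_across:
  assumes F: "F \<notin> B" "supported \<omega> {} F" and F': "F' \<in> B" "supported \<omega> F' UNIV"
  shows "cut.balanced_at cut_weight F F'"
proof -
  \<comment> \<open>The indicator confines \<open>w\<close> to saturated chains of the old order, so
    sums may run over all sets.\<close>
  define w where "w x y = of_bool (covers R F x \<and> covers R x y \<and> covers R y F') *
    (\<omega> F x * \<omega> x y * \<omega> y F')" for x y
  define a where "a y = (\<Sum>x\<in>UNIV. of_bool (selected F y \<in> x) * w x y)" for y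
  define b where "b x = (\<Sum>y\<in>UNIV. of_bool (selected x F' \<in> y) * w x y)" for x
  have wD: "covers R F x \<and> covers R x y \<and> covers R y F'" if "w x y \<noteq> 0" for x y
    using that unfolding w_def by auto
  have selected: "selected G H \<in> H - G" if "e \<in> H - G" for e and G H :: "'e set"
    unfolding selected_def using that by (rule someI)
  have a: "(\<Sum>x\<in>UNIV. of_bool (e \<in> x) * w x y) = a y" if "e \<in> F' - F" "e \<in> y" for e y
  proof -
    have sum_eq: "(\<Sum>x\<in>UNIV. of_bool (e \<in> x) * w x y) = of_bool (covers R y F') * \<omega> y F' *
        (\<Sum>x\<in>between F y. of_bool (e \<in> x) * (\<omega> F x * \<omega> x y))" for e
    proof -
      have "(\<Sum>x\<in>UNIV. of_bool (e \<in> x) * w x y) = (\<Sum>x\<in>between F y. of_bool (e \<in> x) * w x y)"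
        by (rule sum.mono_neutral_right) (auto dest: wD)
      also have "\<dots> = (\<Sum>x\<in>between F y. of_bool (covers R y F') * \<omega> y F' *
          (of_bool (e \<in> x) * (\<omega> F x * \<omega> x y)))"
        by (intro sum.cong) (auto simp: w_def mult_ac)
      finally show ?thesis by (simp only: sum_distrib_left)
    qed
    show ?thesis
    \<comment> \<open>If the last edge has nonzero weight, \<open>y\<close> inherits its support
      from \<open>F'\<close>, and [F, y] is balanced; otherwise every term is zero. The proof of
      \<open>b\<close> mirrors this at the lower end.\<close>
    proof (cases "covers R y F' \<and> \<omega> y F' \<noteq> 0")
      case True
      then have "supported \<omega> y UNIV" using F'(2) supported_Cons by blast
      then have "balanced_at \<omega> F y" using F(2) balanced_iff balanced by blast
      moreover have "e \<in> y - F" using that by blast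
      ultimately have "(\<Sum>x\<in>between F y. of_bool (e \<in> x) * (\<omega> F x * \<omega> x y)) =
          (\<Sum>x\<in>between F y. of_bool (selected F y \<in> x) * (\<omega> F x * \<omega> x y))"
        using selected unfolding balanced_at_def by blast
      then show ?thesis unfolding a_def sum_eq by simp
    qed (auto simp: sum_eq a_def)
  qed
  have b: "(\<Sum>y\<in>UNIV. of_bool (e \<in> y) * w x y) = b x" if "e \<in> F' - F" "e \<notin> x" for e x
  proof -
    have sum_eq: "(\<Sum>y\<in>UNIV. of_bool (e \<in> y) * w x y) = of_bool (covers R F x) * \<omega> F x *
        (\<Sum>y\<in>between x F'. of_bool (e \<in> y) * (\<omega> x y * \<omega> y F'))" for e
    proof -
      have "(\<Sum>y\<in>UNIV. of_bool (e \<in> y) * w x y) = (\<Sum>y\<in>between x F'. of_bool (e \<in> y) * w x y)"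
        by (rule sum.mono_neutral_right) (auto dest: wD)
      also have "\<dots> = (\<Sum>y\<in>between x F'. of_bool (covers R F x) * \<omega> F x *
          (of_bool (e \<in> y) * (\<omega> x y * \<omega> y F')))"
        by (intro sum.cong) (auto simp: w_def mult_ac)
      finally show ?thesis by (simp only: sum_distrib_left)
    qed
    show ?thesis
    proof (cases "covers R F x \<and> \<omega> F x \<noteq> 0")
      case True
      then have "supported \<omega> {} x" using F(2) supported_snoc by blast
      then have "balanced_at \<omega> x F'" using F'(2) balanced_iff balanced by blast
      moreover have "e \<in> F' - x" using that by blast
      ultimately have "(\<Sum>y\<in>between x F'. of_bool (e \<in> y) * (\<omega> x y * \<omega> y F')) =
          (\<Sum>y\<in>between x F'. of_bool (selected x F' \<in> y) * (\<omega> x y * \<omega> y F'))"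
        using selected unfolding balanced_at_def by blast
      then show ?thesis unfolding b_def sum_eq by simp
    qed (auto simp: sum_eq b_def)
  qed
  have sub: "x \<subseteq> y" "x \<in> B \<Longrightarrow> y \<in> B" if "w x y \<noteq> 0" for x y
    using wD[OF that] covers_psubset covers_B by blast+
  \<comment> \<open>For a middle set in the cut, the first edge crosses and carries a jump weight,
    while the second is an old edge. In \<open>lower\<close> the roles are exchanged.\<close>
  have upper: "of_bool (H \<in> cut.between F F') * (cut_weight F H * cut_weight H F') =
      a H - (\<Sum>x\<in>UNIV. of_bool (x \<in> B) * w x H)" if H: "H \<in> B" for H
  proof -
    have "a H - (\<Sum>x\<in>UNIV. of_bool (x \<in> B) * w x H) =
        (\<Sum>x\<in>UNIV. (of_bool (selected F H \<in> x) - of_bool (x \<in> B)) * w x H)"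
      unfolding a_def by (simp only: sum_subtractf[symmetric] left_diff_distrib)
    also have "\<dots> = (\<Sum>x\<in>between F H. (of_bool (selected F H \<in> x) - of_bool (x \<in> B)) * w x H)"
      by (rule sum.mono_neutral_right) (auto dest: wD)
    also have "\<dots> = of_bool (covers R H F') * (jump_weight F H * \<omega> H F')"
      unfolding jump_weight_def sum_distrib_left sum_distrib_right
      by (intro sum.cong) (auto simp: w_def mult_ac)
    also have "\<dots> = of_bool (H \<in> cut.between F F') * (cut_weight F H * cut_weight H F')"
      using H F(1) F'(1) cut_covers_cross[OF F(1) H] cut_covers_upper[OF H]
      unfolding cut_weight_def using jump_weight_empty[of F H] by auto
    finally show ?thesis ..
  qed
  have lower: "of_bool (H \<in> cut.between F F') * (cut_weight F H * cut_weight H F') =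
      b H - (\<Sum>y\<in>UNIV. of_bool (y \<in> B) * w H y)" if H: "H \<notin> B" for H
  proof -
    have "b H - (\<Sum>y\<in>UNIV. of_bool (y \<in> B) * w H y) =
        (\<Sum>y\<in>UNIV. (of_bool (selected H F' \<in> y) - of_bool (y \<in> B)) * w H y)"
      unfolding b_def by (simp only: sum_subtractf[symmetric] left_diff_distrib)
    also have "\<dots> = (\<Sum>y\<in>between H F'. (of_bool (selected H F' \<in> y) - of_bool (y \<in> B)) * w H y)"
      by (rule sum.mono_neutral_right) (auto dest: wD)
    also have "\<dots> = of_bool (covers R F H) * (\<omega> F H * jump_weight H F')"
      unfolding jump_weight_def sum_distrib_left sum_distrib_right
      by (intro sum.cong) (auto simp: w_def mult_ac)
    also have "\<dots> = of_bool (H \<in> cut.between F F') * (cut_weight F H * cut_weight H F')"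
      using H F(1) F'(1) cut_covers_cross[OF H F'(1)] cut_covers_lower[OF H B_UNIV[OF F'(1)]]
      unfolding cut_weight_def using jump_weight_empty[of H F'] by auto
    finally show ?thesis ..
  qed
  have "(\<Sum>H\<in>cut.between F F'. of_bool (e \<in> H) * (cut_weight F H * cut_weight H F')) =
      (\<Sum>H\<in>UNIV. of_bool (e \<in> H) *
        (if H \<in> B then a H - (\<Sum>x\<in>UNIV. of_bool (x \<in> B) * w x H)
         else b H - (\<Sum>y\<in>UNIV. of_bool (y \<in> B) * w H y)))" for e
  proof -
    have "(\<Sum>H\<in>cut.between F F'. of_bool (e \<in> H) * (cut_weight F H * cut_weight H F')) =
        (\<Sum>H\<in>UNIV. of_bool (e \<in> H) * (of_bool (H \<in> cut.between F F') * (cut_weight F H * cut_weight H F')))"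
      by (rule sum.mono_neutral_cong_left) auto
    also have "\<dots> = (\<Sum>H\<in>UNIV. of_bool (e \<in> H) *
        (if H \<in> B then a H - (\<Sum>x\<in>UNIV. of_bool (x \<in> B) * w x H)
         else b H - (\<Sum>y\<in>UNIV. of_bool (y \<in> B) * w H y)))"
    proof (intro sum.cong refl)
      fix H
      show "of_bool (e \<in> H) * (of_bool (H \<in> cut.between F F') * (cut_weight F H * cut_weight H F')) =
          of_bool (e \<in> H) * (if H \<in> B then a H - (\<Sum>x\<in>UNIV. of_bool (x \<in> B) * w x H)
           else b H - (\<Sum>y\<in>UNIV. of_bool (y \<in> B) * w H y))"
        by (cases "H \<in> B") (simp_all only: upper lower if_True if_False not_False_eq_True)
    qed
    finally show ?thesis .
  qed
  note eq = this
  show ?thesis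
    unfolding cut.balanced_at_def eq
    by (intro ballI) (rule two_step_balancing[of w B F' F a b, OF sub a b])
qed

lemma cut_balanced:
  assumes "cut.supported cut_weight {} F" "cut.supported cut_weight F' UNIV"
  shows "cut.balanced_at cut_weight F F'"
proof -
  have sup: "supported \<omega> {} F" "supported \<omega> F' UNIV"
    using assms supported_of_cut by blast+
  then have bal: "balanced_at \<omega> F F'" using balanced_iff balanced by blast
  \<comment> \<open>Covers the pairs on one side of the cut, where neither the intermediate sets nor
    the edge weights change.\<close>
  have transfer: "cut.balanced_at cut_weight F F'" if "cut.between F F' = between F F'"
    and "\<And>G. G \<in> between F F' \<Longrightarrow> cut_weight F G * cut_weight G F' = \<omega> F G * \<omega> G F'"
  proof -
    have eq: "(\<Sum>G\<in>cut.between F F'. of_bool (e \<in> G) * (cut_weight F G * cut_weight G F')) =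
        (\<Sum>G\<in>between F F'. of_bool (e \<in> G) * (\<omega> F G * \<omega> G F'))" for e
      unfolding that(1) using that(2) by (intro sum.cong refl) metis
    show ?thesis using bal unfolding cut.balanced_at_def eq balanced_at_def .
  qed
  consider "F \<in> B" | "F' \<notin> B" | "F \<notin> B" "F' \<in> B" by blast
  then show ?thesis
  proof cases
    case 1
    then have "cut.between F F' = between F F'"
      using cut_covers_upper covers_B by (intro Collect_cong) blast
    moreover have "cut_weight F G * cut_weight G F' = \<omega> F G * \<omega> G F'" if "G \<in> between F F'" for G
      using 1 that covers_B unfolding cut_weight_def by auto
    ultimately show ?thesis by (rule transfer)
  next
    case 2
    show ?thesis
    proof (cases "UNIV \<in> B")
      case True
      have "G \<notin> B" if "G \<in> cut.between F F' \<or> G \<in> between F F'" for G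
        using that 2 cut_covers_B covers_B by blast
      then have "cut.between F F' = between F F'"
        using cut_covers_lower[OF _ True] 2 by (intro Collect_cong) blast
      moreover have "cut_weight F G * cut_weight G F' = \<omega> F G * \<omega> G F'" if "G \<in> between F F'" for G
        using 2 that covers_B unfolding cut_weight_def by auto
      ultimately show ?thesis by (rule transfer)
    next
      \<comment> \<open>This is the empty cut, for which the new order has no coverings.\<close>
      case False
      then have "cut.between F F' = {}"
        unfolding cut_covers_iff cut_covers_def by blast
      show ?thesis unfolding cut.balanced_at_def \<open>cut.between F F' = {}\<close> by simp
    qed
  next
    case 3
    then show ?thesis using cut_balanced_across sup by blast
  qed
qed

section \<open>The divisor as a tropical fan\<close>

lemma tropical_cut_divisor:
  assumes "tropical_fan k X"
  shows "tropical_fan (k - 1) cut_divisor"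
  unfolding tropical_fan_def
proof (intro conjI ballI allI impI)
  \<comment> \<open>Flags are lists, but their cones depend only on the sign and on the set of
    members, which leaves finitely many.\<close>
  have "cones cut_divisor \<subseteq> (\<lambda>(s, C). convex_cone hull flag_gens s C) ` ({1, -1} \<times> UNIV)"
    unfolding cut.cones flag_cone_eq_hull by blast
  then show "finite (cones cut_divisor)" by (rule finite_subset) simp
  fix \<sigma> assume "\<sigma> \<in> cones cut_divisor"
  then obtain s Fs where s: "s \<in> {1, -1}" and max: "maximal_flag cut_order Fs"
    and \<sigma>: "\<sigma> = flag_cone s Fs"
    unfolding cut.cones by blast
  have uni: "unimodular (flag_gens s (set Fs))" by (rule cut.unimodular_flag[OF max s])
  then show "rational_cone \<sigma>"
    unfolding rational_cone_def \<sigma> flag_cone_eq_hull unimodular_def by blast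
  show "weight cut_divisor \<sigma> \<in> \<int>" unfolding \<sigma> using cut.weight[OF s max] by simp
  obtain As F G F' Bs where Fs: "Fs = As @ F # F' # Bs" "maximal_flag R (As @ F # G # F' # Bs)"
    using maximal_flag_cut_cases[OF max] by metis
  have "flag_cone s (As @ F # G # F' # Bs) \<in> cones X" using Fs(2) s unfolding cones by blast
  \<comment> \<open>The refilled flag has one member more. It has at least three, so the subtraction
    in \<open>k - 1\<close> is not truncated as soon as the divisor has a cone.\<close>
  then have "k = length (As @ F # G # F' # Bs) - 1"
    using assms dim_flag_cone[OF Fs(2) s] unfolding tropical_fan_def by simp
  then show "dim \<sigma> = k - 1" unfolding \<sigma> using cut.dim_flag_cone[OF max s] Fs(1) by simp
next
  have facet: "\<exists>\<sigma>'\<in>cones X. \<sigma> face_of \<sigma>'" if "\<sigma> \<in> cones cut_divisor" for \<sigma>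
  proof -
    obtain s Fs where s: "s \<in> {1, -1}" "maximal_flag cut_order Fs" "\<sigma> = flag_cone s Fs"
      using \<open>\<sigma> \<in> cones cut_divisor\<close> unfolding cut.cones by blast
    obtain As F G F' Bs where Fs: "Fs = As @ F # F' # Bs" "maximal_flag R (As @ F # G # F' # Bs)"
      using maximal_flag_cut_cases[OF s(2)] by metis
    show ?thesis
      using facet_of_imp_face_of[OF gap_facet[OF Fs(2) s(1)]] Fs s unfolding cones by blast
  qed
  fix \<sigma> \<sigma>' assume "\<sigma> \<in> cones cut_divisor" "\<sigma>' \<in> cones cut_divisor"
  then obtain \<rho> \<rho>' where \<rho>: "\<rho> \<in> cones X" "\<sigma> face_of \<rho>" and \<rho>': "\<rho>' \<in> cones X" "\<sigma>' face_of \<rho>'"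
    using facet by blast
  \<comment> \<open>The intersection property is inherited from \<open>X\<close>, because the cones
    of the divisor are faces of cones of \<open>X\<close>.\<close>
  have "\<sigma> \<inter> \<sigma>' face_of \<rho> \<inter> \<rho>'" using \<rho>(2) \<rho>'(2) by (rule face_of_Int_Int)
  also have "\<rho> \<inter> \<rho>' face_of \<rho>" using assms \<rho>(1) \<rho>'(1) unfolding tropical_fan_def by blast
  finally show "\<sigma> \<inter> \<sigma>' face_of \<sigma>"
    using \<rho>(2) by (meson face_of_imp_subset face_of_subset inf_le1)
next
  fix \<tau> assume "star cut_divisor \<tau> \<noteq> {}"
  then show "(\<Sum>\<sigma>\<in>star cut_divisor \<tau>. weight cut_divisor \<sigma> *\<^sub>R primitive_vec \<sigma> \<tau>) \<in> span \<tau>"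
    using cut.balanced_iff cut_balanced unfolding cut.star_sum_def by blast
qed

text \<open>The Weil divisor has more cones: base cones and gaps that do not cross the cut. All of
  these have weight zero, which \<open>same_fan\<close> ignores.\<close>

lemma same_fan_cut_divisor: "same_fan (weil_divisor \<phi> X) cut_divisor"
  unfolding same_fan_def
proof
  fix \<tau>
  have weight_eq: "weight (weil_divisor \<phi> X) = weight cut_divisor" unfolding cut_divisor_def by simp
  have mem: "\<tau> \<in> cones (weil_divisor \<phi> X)" if "\<tau> \<in> cones cut_divisor"
  proof -
    obtain s Fs where s: "s \<in> {1, -1}" "maximal_flag cut_order Fs" "\<tau> = flag_cone s Fs"
      using \<open>\<tau> \<in> cones cut_divisor\<close> unfolding cut.cones by blast
    obtain As F G F' Bs where Fs: "Fs = As @ F # F' # Bs" "maximal_flag R (As @ F # G # F' # Bs)"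
      using maximal_flag_cut_cases[OF s(2)] by metis
    show ?thesis
      using gap_facet[OF Fs(2) s(1)] Fs s unfolding weil_divisor_def cones by auto
  qed
  have "weight (weil_divisor \<phi> X) \<tau> = 0"
    if \<tau>: "\<tau> \<in> cones (weil_divisor \<phi> X)" "\<tau> \<notin> cones cut_divisor"
  proof -
    obtain s Fs where s: "s \<in> {1, -1}" "maximal_flag R Fs" "\<tau> facet_of flag_cone s Fs"
    proof -
      have "\<exists>\<sigma>\<in>cones X. \<tau> facet_of \<sigma>" using \<tau>(1) unfolding weil_divisor_def by simp
      then show thesis using that unfolding cones by blast
    qed
    show ?thesis using s(2,1,3)
    proof (cases rule: flag_facet_cases)
      case base
      then show ?thesis using weil_divisor_base[OF s(2)] by simp
    next
      case (gap As F G F' Bs)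
      have "\<not> (F \<notin> B \<and> F' \<in> B)"
        using \<tau>(2) s(1,2) maximal_flag_cut_iff[of F F' As Bs] gap unfolding cut.cones by blast
      then show ?thesis unfolding gap(2) weil_divisor_gap[OF s(2)[unfolded gap(1)] s(1)] by auto
    qed
  qed
  with mem show "eff_weight (weil_divisor \<phi> X) \<tau> = eff_weight cut_divisor \<tau>"
    unfolding eff_weight_def weight_eq by auto
qed

end

theorem lemma3p7:
  fixes X :: "(real ^ 'e::finite) weighted_fan"
    and \<G> \<A> :: "'e set set"
    and R :: "('e set \<times> 'e set) set"
    and \<omega> :: "'e set \<Rightarrow> 'e set \<Rightarrow> int"
    and \<phi> :: "real ^ 'e \<Rightarrow> real"
    and k :: nat
  assumes "flag_fan_of k \<G> R \<omega> X"
    and "is_cut \<G> \<A>"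
    and "cut_function X \<G> \<A> \<phi>"
  shows "is_flag_fan (k - 1) (weil_divisor \<phi> X)"
proof -
  have fan: "ranked_set_poset \<G> R" "tropical_fan k X"
    "cones X = {flag_cone s Fs | s Fs. s \<in> {1, -1} \<and> maximal_flag R Fs}"
    "\<And>s Fs. s \<in> {1, -1} \<Longrightarrow> maximal_flag R Fs \<Longrightarrow>
       weight X (flag_cone s Fs) = of_int (flag_weight \<omega> Fs)"
    using assms(1) unfolding flag_fan_of_def by blast+
  \<comment> \<open>Interpreted before \<open>cut_fan\<close>, so that \<open>star_sum_def\<close>
    is available when the balancing assumption of \<open>cut_fan\<close> is discharged.\<close>
  interpret flag_fan \<G> R X \<omega> using fan by unfold_locales
  interpret cut_fan \<G> R X \<omega> \<A> \<phi>
    using assms(2,3) fan(2) by unfold_locales (auto simp: star_sum_def tropical_fan_def)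
  have "flag_fan_of (k - 1) \<G> cut_order cut_weight cut_divisor"
    unfolding flag_fan_of_def
    using ranked_cut_order tropical_cut_divisor[OF fan(2)] cut.cones cut.weight by blast
  then show ?thesis unfolding is_flag_fan_def using same_fan_cut_divisor by blast
qed

end
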